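(* Let $b_2,b_2'\in L^\infty(\mathbb{R}^m)$ be pseudo-accretive, let $a\in BMO(\mathbb{R}^m)$, and let $\mathcal{D}^m$ be a dyadic grid on $\mathbb{R}^m$. Then the partial paraproduct $$\pi_a^{b_2',b_2}(f)=\sum_{V\in\mathcal{D}^m}\langle f\rangle_V^{b_2'}\,M_{b_2}\Delta_V^{b_2}a$$ is bounded on $L^2(\mathbb{R}^m)$, with $$\|\pi_a^{b_2',b_2}(f)\|_{L^2(\mathbb{R}^m)}\le C\|a\|_{BMO}\|f\|_{L^2(\mathbb{R}^m)}\quad\text{for all } f\in L^2(\mathbb{R}^m),$$ where $C$ depends only on $m$ and the $L^\infty$ and pseudo-accretivity constants of $b_2,b_2'$. The analogous inequality holds on $\mathbb{R}^n$ for $\pi_a^{b_1',b_1}(f)=\sum_{K\in\mathcal{D}^n}\langle f\rangle_K^{b_1'}M_{b_1}\Delta_K^{b_1}a$, with $b_1,b_1'\in L^\infty(\mathbb{R}^n)$ pseudo-accretive, $a\in BMO(\mathbb{R}^n)$, and $\mathcal{D}^n$ a dyadic grid on $\mathbb{R}^n$.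
   Context: A function $\beta\in L^\infty(\mathbb{R}^m)$ is pseudo-accretive if there is $C>0$ with $\frac1{|V|}|\int_V\beta|>C$ for every cube $V$. A dyadic grid $\mathcal{D}^m$ is a shift $\{I+\sum_{i:2^{-i}<\ell(I)}2^{-i}\omega_i: I\in\mathcal{D}^m_0\}$ of the standard dyadic grid $\mathcal{D}^m_0$, $\omega_i\in\{0,1\}^m$, $i\in\mathbb{Z}$; $\mathcal{D}^m_q$ is the set of its cubes of side $2^{-q}$. Define $\langle f\rangle_V^\beta=\frac{\int_Vf\beta}{\int_V\beta}$, $E_q^\beta f=\sum_{V\in\mathcal{D}^m_q}\langle f\rangle_V^\beta\chi_V$, $\Delta_q^\beta=E_{q+1}^\beta-E_q^\beta$, and $\Delta_V^\beta f=\chi_V\Delta_q^\beta f$ for $V\in\mathcal{D}^m_q$. $M_\beta f=\beta f$. $BMO$ is the classical one-parameter space, with norm $\|a\|_{BMO}=\sup_V\left(\frac1{|V|}\int_V|a-\frac1{|V|}\int_Va|^2\right)^{1/2}$. The series defining the paraproduct is understood weakly, via pairing with $L^2$ functions. *)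

theory Defs
  imports "HOL-Analysis.Analysis" "HOL-Probability.Essential_Supremum"
begin

text \<open>Cubes are half-open and axis-parallel. Dyadic cubes then partition space exactly; in all
  conditions that range over arbitrary cubes, boundaries are null sets and do not matter.\<close>

definition cube :: "real^'m \<Rightarrow> real \<Rightarrow> (real^'m) set" where
  "cube p l = {x. \<forall>i. p $ i \<le> x $ i \<and> x $ i < p $ i + l}"

definition cubes :: "(real^'m) set set" where
  "cubes = {cube p l | p l. 0 < l}"

definition side :: "(real^'m) set \<Rightarrow> real" where
  "side V = (THE l. 0 < l \<and> (\<exists>p. V = cube p l))"

lemma cube_lower_corner: "0 < l \<Longrightarrow> p \<in> cube p l"
  by (simp add: cube_def)

lemma cube_eqD:
  fixes p q :: "real^'m"
  assumes "0 < l" "0 < k" "cube p l = cube q k"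
  shows "p = q \<and> l = k"
proof -
  have "p \<in> cube q k" "q \<in> cube p l"
    using assms cube_lower_corner by blast+
  then have pq: "p = q"
    by (auto simp: cube_def vec_eq_iff intro: order_antisym)
  have "\<not> l < k" if "cube p l = cube p k" "0 < l" for l k :: real
  proof
    assume "l < k"
    then have "(\<chi> i. p $ i + l) \<in> cube p k" using that(2) by (simp add: cube_def)
    then have "(\<chi> i. p $ i + l) \<in> cube p l" using that(1) by simp
    then show False by (simp add: cube_def)
  qed
  from this[of l k] this[of k l] show ?thesis using pq assms by auto
qed

lemma side_cube: "0 < l \<Longrightarrow> side (cube p l) = l"
  unfolding side_def using cube_eqD by (intro the_equality) blast+

definition mean :: "(real^'m) set \<Rightarrow> (real^'m \<Rightarrow> complex) \<Rightarrow> complex" where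
  "mean V f = (LINT x:V|lebesgue. f x) / complex_of_real (measure lebesgue V)"

definition L2 :: "(real^'m \<Rightarrow> complex) set" where
  "L2 = {f \<in> borel_measurable lebesgue. integrable lebesgue (\<lambda>x. (cmod (f x))\<^sup>2)}"

definition L2_norm :: "(real^'m \<Rightarrow> complex) \<Rightarrow> real" where
  "L2_norm f = sqrt (LINT x|lebesgue. (cmod (f x))\<^sup>2)"

definition Linfty_norm :: "(real^'m \<Rightarrow> complex) \<Rightarrow> ereal" where
  "Linfty_norm f = esssup lebesgue (\<lambda>x. ereal (cmod (f x)))"

definition Linfty :: "(real^'m \<Rightarrow> complex) set" where
  "Linfty = {f \<in> borel_measurable lebesgue. Linfty_norm f < \<infinity>}"

definition pseudo_accretive :: "real \<Rightarrow> (real^'m \<Rightarrow> complex) \<Rightarrow> bool" where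
  "pseudo_accretive c \<beta> \<longleftrightarrow> 0 < c \<and>
     (\<forall>V\<in>cubes. 1 / measure lebesgue V * cmod (LINT x:V|lebesgue. \<beta> x) > c)"

definition mean_oscillation :: "(real^'m) set \<Rightarrow> (real^'m \<Rightarrow> complex) \<Rightarrow> real" where
  "mean_oscillation V a =
     sqrt (1 / measure lebesgue V * (LINT x:V|lebesgue. (cmod (a x - mean V a))\<^sup>2))"

text \<open>The integrability clauses are needed because the library gives non-integrable functions
  the integral 0; together with \<open>bdd_above\<close> they express that the supremum is finite.\<close>

definition BMO :: "(real^'m \<Rightarrow> complex) set" where
  "BMO = {a \<in> borel_measurable lebesgue.
     (\<forall>V\<in>cubes. set_integrable lebesgue V a \<and>
        set_integrable lebesgue V (\<lambda>x. (cmod (a x - mean V a))\<^sup>2)) \<and>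
     bdd_above ((\<lambda>V. mean_oscillation V a) ` cubes)}"

definition BMO_norm :: "(real^'m \<Rightarrow> complex) \<Rightarrow> real" where
  "BMO_norm a = (SUP V\<in>cubes. mean_oscillation V a)"

definition standard_grid :: "(real^'m) set set" where
  "standard_grid =
     {cube (\<chi> i. 2 powi (- q) * real_of_int (k i)) (2 powi (- q)) | (q :: int) k. True}"

definition shifted_grid :: "(int \<Rightarrow> real^'m) \<Rightarrow> (real^'m) set set" where
  "shifted_grid \<omega> =
     {(\<lambda>x. x + (\<Sum>\<^sub>\<infinity>i\<in>{i::int. 2 powi (- i) < side I}. 2 powi (- i) *\<^sub>R \<omega> i)) ` I | I.
        I \<in> standard_grid}"

definition dyadic_grid :: "(real^'m) set set \<Rightarrow> bool" where
  "dyadic_grid D \<longleftrightarrow> (\<exists>\<omega>. (\<forall>i k. \<omega> i $ k \<in> {0, 1}) \<and> D = shifted_grid \<omega>)"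

definition grid_level :: "(real^'m) set set \<Rightarrow> int \<Rightarrow> (real^'m) set set" where
  "grid_level D q = {V \<in> D. side V = 2 powi (- q)}"

definition weighted_mean ::
    "(real^'m \<Rightarrow> complex) \<Rightarrow> (real^'m) set \<Rightarrow> (real^'m \<Rightarrow> complex) \<Rightarrow> complex" where
  "weighted_mean \<beta> V f = (LINT x:V|lebesgue. f x * \<beta> x) / (LINT x:V|lebesgue. \<beta> x)"

text \<open>At each point at most one term of the following sum is nonzero.\<close>

definition E_op :: "(real^'m) set set \<Rightarrow> (real^'m \<Rightarrow> complex) \<Rightarrow> int \<Rightarrow>
    (real^'m \<Rightarrow> complex) \<Rightarrow> real^'m \<Rightarrow> complex" where
  "E_op D \<beta> q f x = (\<Sum>\<^sub>\<infinity>V\<in>grid_level D q. weighted_mean \<beta> V f * indicator V x)"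

definition Delta_level :: "(real^'m) set set \<Rightarrow> (real^'m \<Rightarrow> complex) \<Rightarrow> int \<Rightarrow>
    (real^'m \<Rightarrow> complex) \<Rightarrow> real^'m \<Rightarrow> complex" where
  "Delta_level D \<beta> q f x = E_op D \<beta> (q + 1) f x - E_op D \<beta> q f x"

definition Delta_cube :: "(real^'m) set set \<Rightarrow> (real^'m \<Rightarrow> complex) \<Rightarrow> (real^'m) set \<Rightarrow>
    (real^'m \<Rightarrow> complex) \<Rightarrow> real^'m \<Rightarrow> complex" where
  "Delta_cube D \<beta> V f x =
     indicator V x * Delta_level D \<beta> (THE q. V \<in> grid_level D q) f x"

definition M_op :: "(real^'m \<Rightarrow> complex) \<Rightarrow> (real^'m \<Rightarrow> complex) \<Rightarrow> real^'m \<Rightarrow> complex" where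
  "M_op \<beta> f x = \<beta> x * f x"

definition pairing :: "(real^'m \<Rightarrow> complex) \<Rightarrow> (real^'m \<Rightarrow> complex) \<Rightarrow> complex" where
  "pairing f g = (LINT x|lebesgue. f x * g x)"

text \<open>\<open>is_paraproduct D \<beta>' \<beta> a f h\<close>: the series
  \<open>\<Sum>V\<in>D. weighted_mean \<beta>' V f * M_op \<beta> (Delta_cube D \<beta> V a)\<close> converges weakly (and
  unconditionally) in \<open>L2\<close> to \<open>h\<close>. Such an \<open>h\<close> is determined up to a null set.\<close>

definition is_paraproduct :: "(real^'m) set set \<Rightarrow> (real^'m \<Rightarrow> complex) \<Rightarrow>
    (real^'m \<Rightarrow> complex) \<Rightarrow> (real^'m \<Rightarrow> complex) \<Rightarrow> (real^'m \<Rightarrow> complex) \<Rightarrow>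
    (real^'m \<Rightarrow> complex) \<Rightarrow> bool" where
  "is_paraproduct D \<beta>' \<beta> a f h \<longleftrightarrow> h \<in> L2 \<and>
     (\<forall>g\<in>L2. ((\<lambda>V. pairing (\<lambda>x. weighted_mean \<beta>' V f * M_op \<beta> (Delta_cube D \<beta> V a) x) g)
        has_sum pairing h g) D)"

end

theory Submission
  imports Defs
begin

text \<open>
  Write \<open>d\<^sub>W = \<langle>a\<rangle>\<^sub>W - \<langle>a\<rangle>\<^sub>V\<close> for the jump of the \<open>\<beta>\<close>-weighted mean of \<open>a\<close> from a cube \<open>V\<close> of the grid to
  its child \<open>W\<close>, and \<open>e\<^sub>W\<close> for the same jump of a test function \<open>g\<close>. On \<open>V\<close> the function \<open>\<Delta>\<^sub>V a\<close> takes
  the value \<open>d\<^sub>W\<close> on \<open>W\<close>, and \<open>\<beta> \<Delta>\<^sub>V a\<close> has integral zero. So pairing it with \<open>g\<close> gives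
  \<open>\<Sum>\<^sub>W d\<^sub>W e\<^sub>W \<integral>\<^sub>W \<beta>\<close>, and by Cauchy-Schwarz this is at most \<open>B\<close> times the product of the jump energies
  \<open>\<Sum>\<^sub>W |d\<^sub>W|\<^sup>2 |W|\<close> and \<open>\<Sum>\<^sub>W |e\<^sub>W|\<^sup>2 |W|\<close>, each to the power one half. Two estimates then bound every
  finite partial sum of the paraproduct.

  \<^item> The square function estimate (\<open>square_function\<close>): the jump energies of \<open>g\<close> add up to at most a
    constant times \<open>\<parallel>g\<parallel>\<^sup>2\<close>.

  \<^item> The Carleson estimate (\<open>paraproduct_coefficients\<close>): the jump energies of \<open>a\<close>, weighted with the
    squares of the means of \<open>|f|\<close>, add up to at most a constant times \<open>\<parallel>a\<parallel>\<^sup>2 \<parallel>f\<parallel>\<^sup>2\<close>. It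
    rests on \<open>BMO_carleson\<close>: below a cube \<open>W\<close> the jumps of \<open>a\<close> are those of \<open>a\<close> minus its mean on \<open>W\<close>,
    so that the square function estimate on \<open>W\<close> bounds their energy by the mean oscillation.

  Both are consequences of facts about trees of weighted sets, in which a function enters only through
  its integrals over the nodes. Without the weight \<open>\<beta>\<close> the square function estimate is orthogonality of
  martingale differences, proved as a telescoping sum over generations. A quotient \<open>G/\<Phi>\<close> of
  two such martingales jumps either because \<open>G\<close> jumps or because \<open>\<Phi>\<close> jumps. The second contribution is
  the energy of the jumps of \<open>\<Phi>\<close> weighted with squared means of \<open>G\<close>, and this is where Carleson embedding
  is used for the first time (\<open>adapted_square_function\<close>). The embedding theorem itself is proved by the
  Bellman function \<open>4A (F - J\<^sup>2 / (\<mu> + S/A))\<close>, again one generation at a time.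

  Together they bound the squared norm of a finite partial sum by the sum of a fixed summable family over
  the same cubes (\<open>partial_sum_bound\<close>), so the partial sums form a Cauchy net in \<open>L2\<close>. Their
  limit is constructed as a pointwise limit along a rapidly convergent sequence of finite sets
  (\<open>L2_unconditional_series\<close>). It is the limit in norm, hence weakly, over all finite sets of cubes.
\<close>

section \<open>Square functions and Carleson embedding on weighted trees\<close>

text \<open>Summing generation by generation makes each estimate on a tree an induction on the depth whose step
  passes from a node to its children only.\<close>

primrec descent_sum :: "('v \<Rightarrow> 'v set) \<Rightarrow> ('v \<Rightarrow> real) \<Rightarrow> nat \<Rightarrow> 'v \<Rightarrow> real" where
  "descent_sum ch t 0 v = 0"
| "descent_sum ch t (Suc n) v = t v + (\<Sum>w\<in>ch v. descent_sum ch t n w)"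

primrec generation :: "('v \<Rightarrow> 'v set) \<Rightarrow> nat \<Rightarrow> 'v \<Rightarrow> 'v set" where
  "generation ch 0 v = {v}"
| "generation ch (Suc n) v = (\<Union>w\<in>ch v. generation ch n w)"

lemma descent_sum_nonneg: "(\<And>v. 0 \<le> t v) \<Longrightarrow> 0 \<le> descent_sum ch t n v"
  by (induction n arbitrary: v) (auto intro!: add_nonneg_nonneg sum_nonneg)

lemma sum_Un_le:
  fixes t :: "'v \<Rightarrow> real"
  assumes "finite X" "finite Y" "\<And>x. x \<in> X \<union> Y \<Longrightarrow> 0 \<le> t x"
  shows "sum t (X \<union> Y) \<le> sum t X + sum t Y"
  using assms sum.union_inter[of X Y t] sum_nonneg[of "X \<inter> Y" t] by simp

lemma sum_UN_le:
  fixes t :: "'v \<Rightarrow> real"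
  assumes "finite S" "\<And>w. w \<in> S \<Longrightarrow> finite (Y w)" "\<And>w x. w \<in> S \<Longrightarrow> x \<in> Y w \<Longrightarrow> 0 \<le> t x"
  shows "sum t (\<Union>w\<in>S. Y w) \<le> (\<Sum>w\<in>S. sum t (Y w))"
  using assms
proof (induction S rule: finite_induct)
  case (insert w S)
  have "sum t (Y w \<union> (\<Union>w\<in>S. Y w)) \<le> sum t (Y w) + sum t (\<Union>w\<in>S. Y w)"
    using insert by (intro sum_Un_le) auto
  then show ?case using insert by fastforce
qed simp

text \<open>The weighted mean of the quotients \<open>x w / a w\<close> is \<open>sum x S / sum a S\<close>; this is the usual formula
  for a variance. With \<open>x\<close> the integrals of a function and \<open>a\<close> the measures it says that the energy of
  one generation of jumps is a difference of squared norms.\<close>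

lemma weighted_variance:
  fixes x :: "'v \<Rightarrow> 'b::real_inner" and a :: "'v \<Rightarrow> real"
  assumes "finite S" "\<And>w. w \<in> S \<Longrightarrow> 0 < a w" "S \<noteq> {}"
  shows "(\<Sum>w\<in>S. (norm (x w /\<^sub>R a w - sum x S /\<^sub>R sum a S))\<^sup>2 * a w)
       = (\<Sum>w\<in>S. (norm (x w))\<^sup>2 / a w) - (norm (sum x S))\<^sup>2 / sum a S"
proof -
  define k where "k = sum x S /\<^sub>R sum a S"
  have pos: "0 < sum a S" using assms by (intro sum_pos) auto
  have "(\<Sum>w\<in>S. (norm (x w /\<^sub>R a w - k))\<^sup>2 * a w)
      = (\<Sum>w\<in>S. (norm (x w))\<^sup>2 / a w - 2 * inner (x w) k + (norm k)\<^sup>2 * a w)"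
  proof (intro sum.cong refl)
    fix w assume "w \<in> S"
    then have "0 < a w" using assms by blast
    then show "(norm (x w /\<^sub>R a w - k))\<^sup>2 * a w = (norm (x w))\<^sup>2 / a w - 2 * inner (x w) k + (norm k)\<^sup>2 * a w"
      by (simp add: power2_norm_eq_inner inner_diff_left inner_diff_right inner_commute field_simps)
  qed
  also have "\<dots> = (\<Sum>w\<in>S. (norm (x w))\<^sup>2 / a w) - 2 * inner (sum x S) k + (norm k)\<^sup>2 * sum a S"
    by (simp add: sum.distrib sum_subtractf inner_sum_left sum_distrib_left)
  also have "2 * inner (sum x S) k = 2 * ((norm (sum x S))\<^sup>2 / sum a S)"
    by (simp add: k_def power2_norm_eq_inner divide_inverse)
  also have "(norm k)\<^sup>2 * sum a S = (norm (sum x S))\<^sup>2 / sum a S"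
    using pos by (simp add: k_def power_mult_distrib power2_eq_square field_simps)
  finally show ?thesis by (simp add: k_def)
qed

text \<open>Joint convexity of \<open>(x, a) \<mapsto> x\<^sup>2 / a\<close>, because the variance is nonnegative.\<close>

lemma sum_square_divide_ge:
  fixes x a :: "'v \<Rightarrow> real"
  assumes "finite S" "\<And>w. w \<in> S \<Longrightarrow> 0 < a w" "S \<noteq> {}"
  shows "(sum x S)\<^sup>2 / sum a S \<le> (\<Sum>w\<in>S. (x w)\<^sup>2 / a w)"
proof -
  have "0 \<le> (\<Sum>w\<in>S. (norm (x w /\<^sub>R a w - sum x S /\<^sub>R sum a S))\<^sup>2 * a w)"
    using assms(2) by (intro sum_nonneg mult_nonneg_nonneg) (auto intro: less_imp_le)
  then show ?thesis using weighted_variance[OF assms, where x = x] by simp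
qed

locale measured_tree =
  fixes T :: "'v set" and ch :: "'v \<Rightarrow> 'v set" and \<mu> :: "'v \<Rightarrow> real"
  assumes finite_ch: "v \<in> T \<Longrightarrow> finite (ch v)"
    and ch_closed: "v \<in> T \<Longrightarrow> w \<in> ch v \<Longrightarrow> w \<in> T"
    and mu_pos: "v \<in> T \<Longrightarrow> 0 < \<mu> v"
    and mu_additive: "v \<in> T \<Longrightarrow> sum \<mu> (ch v) = \<mu> v"
begin

definition additive :: "('v \<Rightarrow> 'b::comm_monoid_add) \<Rightarrow> bool" where
  "additive F \<longleftrightarrow> (\<forall>v\<in>T. sum F (ch v) = F v)"

text \<open>If \<open>r\<close> assigns to each cube the weighted mean of a function, this is the squared norm of the
  martingale difference of that function on \<open>v\<close>.\<close>

definition jump_energy :: "('v \<Rightarrow> complex) \<Rightarrow> 'v \<Rightarrow> real" where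
  "jump_energy r v = (\<Sum>w\<in>ch v. (cmod (r w - r v))\<^sup>2 * \<mu> w)"

lemma ch_nonempty: "v \<in> T \<Longrightarrow> ch v \<noteq> {}"
  using mu_additive mu_pos by fastforce

lemma descent_sum_mono:
  assumes "v \<in> T" "\<And>v. v \<in> T \<Longrightarrow> s v \<le> t v"
  shows "descent_sum ch s n v \<le> descent_sum ch t n v"
  using assms(1)
proof (induction n arbitrary: v)
  case (Suc n)
  then show ?case using assms(2)[of v] ch_closed
    by (auto intro!: add_mono sum_mono)
qed simp

lemma descent_sum_lincomb:
  "descent_sum ch (\<lambda>v. k * s v + l * t v) n v
     = k * descent_sum ch s n v + l * descent_sum ch t n v"
proof (induction n arbitrary: v)
  case (Suc n)
  then show ?case by (simp add: sum.distrib sum_distrib_left algebra_simps)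
qed simp

text \<open>Sums by generations dominate sums over arbitrary finite sets of descendants. The induction step is
  subadditivity of sums of nonnegative terms over unions.\<close>

lemma descent_sum_generations:
  assumes "v \<in> T" "\<And>v. v \<in> T \<Longrightarrow> 0 \<le> t v" "finite X" "X \<subseteq> (\<Union>k<n. generation ch k v)"
  shows "sum t X \<le> descent_sum ch t n v"
  using assms(1,3,4)
proof (induction n arbitrary: v X)
  case 0 then show ?case by simp
next
  case (Suc n)
  have X: "X \<subseteq> {v} \<union> (\<Union>w\<in>ch v. \<Union>k<n. generation ch k w)"
  proof
    fix x assume "x \<in> X"
    then obtain k where "k < Suc n" "x \<in> generation ch k v" using Suc.prems by auto
    then show "x \<in> {v} \<union> (\<Union>w\<in>ch v. \<Union>k<n. generation ch k w)"
      by (cases k) auto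
  qed
  have inT: "x \<in> T" if "w \<in> T" "x \<in> generation ch k w" for x k w
    using that by (induction k arbitrary: w) (auto intro: ch_closed)
  define Y where "Y w = X \<inter> (\<Union>k<n. generation ch k w)" for w
  have fY: "finite (Y w)" for w using Suc.prems by (simp add: Y_def)
  have nn: "0 \<le> t x" if x: "x \<in> {v} \<union> (\<Union>w\<in>ch v. Y w)" for x
  proof (rule assms(2))
    consider "x = v" | w k where "w \<in> ch v" "x \<in> generation ch k w" using x by (auto simp: Y_def)
    then show "x \<in> T" using Suc.prems(1) inT ch_closed by cases blast+
  qed
  have fU: "finite (\<Union>w\<in>ch v. Y w)" using fY finite_ch[OF Suc.prems(1)] by blast
  have "X \<subseteq> {v} \<union> (\<Union>w\<in>ch v. Y w)" using X unfolding Y_def by blast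
  then have "sum t X \<le> sum t ({v} \<union> (\<Union>w\<in>ch v. Y w))"
    using fU nn by (intro sum_mono2) blast+
  also have "\<dots> \<le> sum t {v} + sum t (\<Union>w\<in>ch v. Y w)"
    using fU nn by (intro sum_Un_le) blast+
  also have "sum t (\<Union>w\<in>ch v. Y w) \<le> (\<Sum>w\<in>ch v. sum t (Y w))"
    using nn fY finite_ch[OF Suc.prems(1)] by (intro sum_UN_le) blast+
  also have "(\<Sum>w\<in>ch v. sum t (Y w)) \<le> (\<Sum>w\<in>ch v. descent_sum ch t n w)"
  proof (rule sum_mono)
    fix w assume "w \<in> ch v"
    then show "sum t (Y w) \<le> descent_sum ch t n w"
      using Suc.IH[of w "Y w"] fY ch_closed[OF Suc.prems(1)] unfolding Y_def by blast
  qed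
  finally show ?case by simp
qed

text \<open>The subtracted term makes the induction telescope: the energy of the jumps out of \<open>v\<close> is what the
  squared means gain from one generation to the next.\<close>

lemma martingale_square_function:
  fixes I :: "'v \<Rightarrow> complex"
  assumes "additive I" "additive F" "\<And>v. v \<in> T \<Longrightarrow> (cmod (I v))\<^sup>2 \<le> F v * \<mu> v" "v \<in> T"
  shows "descent_sum ch (jump_energy (\<lambda>v. I v /\<^sub>R \<mu> v)) n v \<le> F v - (cmod (I v))\<^sup>2 / \<mu> v"
  using assms(4)
proof (induction n arbitrary: v)
  case 0
  then show ?case using assms(3) mu_pos by (auto simp: field_simps)
next
  case (Suc n)
  have "jump_energy (\<lambda>v. I v /\<^sub>R \<mu> v) v = (\<Sum>w\<in>ch v. (cmod (I w))\<^sup>2 / \<mu> w) - (cmod (I v))\<^sup>2 / \<mu> v"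
    using weighted_variance[OF finite_ch[OF Suc.prems] _ ch_nonempty[OF Suc.prems], of \<mu> I]
      Suc.prems mu_pos ch_closed mu_additive assms(1)
    by (simp add: jump_energy_def additive_def)
  moreover have "(\<Sum>w\<in>ch v. descent_sum ch (jump_energy (\<lambda>v. I v /\<^sub>R \<mu> v)) n w)
      \<le> (\<Sum>w\<in>ch v. F w - (cmod (I w))\<^sup>2 / \<mu> w)"
    using Suc.prems ch_closed by (intro sum_mono Suc.IH) auto
  moreover have "sum F (ch v) = F v" using assms(2) Suc.prems by (simp add: additive_def)
  ultimately show ?case by (simp add: sum_subtractf)
qed

text \<open>The proof finds a Bellman function. Let \<open>S\<close> be the mass of \<open>\<alpha>\<close> in the first \<open>n\<close> generations
  below \<open>v\<close>. The bound \<open>4A (F - J\<^sup>2 / (\<mu> + S/A))\<close> is inherited from the children by convexity of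
  \<open>J\<^sup>2 / (\<mu> + S/A)\<close>, and the Carleson condition \<open>S \<le> A \<mu>\<close> keeps the denominator at most \<open>2\<mu>\<close>. Adding
  \<open>\<alpha> v\<close> to \<open>S\<close> therefore raises the bound by at least \<open>\<alpha> v (J/\<mu>)\<^sup>2\<close>, which is the term of \<open>v\<close> itself.\<close>

lemma carleson_embedding:
  fixes A :: real
  assumes add: "additive J" "additive F"
    and cs: "\<And>v. v \<in> T \<Longrightarrow> (J v)\<^sup>2 \<le> F v * \<mu> v"
    and \<alpha>: "\<And>v. 0 \<le> \<alpha> v" and A: "0 \<le> A"
    and carleson: "\<And>n v. v \<in> T \<Longrightarrow> descent_sum ch \<alpha> n v \<le> A * \<mu> v"
    and v: "v \<in> T"
  shows "descent_sum ch (\<lambda>v. \<alpha> v * (J v / \<mu> v)\<^sup>2) n v \<le> 4 * A * F v"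
proof -
  have strict: "descent_sum ch (\<lambda>v. \<alpha> v * (J v / \<mu> v)\<^sup>2) n v
      \<le> 4 * A * (F v - (J v)\<^sup>2 / (\<mu> v + descent_sum ch \<alpha> n v / A))"
    if A: "0 < A" and carleson: "\<And>n v. v \<in> T \<Longrightarrow> descent_sum ch \<alpha> n v \<le> A * \<mu> v" and v: "v \<in> T" for A v
    using v
  proof (induction n arbitrary: v)
    case 0
    then show ?case using cs[of v] mu_pos[of v] A by (auto simp: field_simps)
  next
    case (Suc n)
    note v = Suc.prems
    define S where "S w = descent_sum ch \<alpha> n w" for w
    define a where "a w = \<mu> w + S w / A" for w
    have S: "0 \<le> S w" for w unfolding S_def using \<alpha> by (rule descent_sum_nonneg)
    have apos: "0 < a w" if "w \<in> T" for w using mu_pos[OF that] S[of w] A by (simp add: a_def add_pos_nonneg)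
    define s where "s = sum a (ch v)"
    have s: "s = \<mu> v + sum S (ch v) / A"
      using mu_additive[OF v] by (simp add: s_def a_def sum.distrib sum_divide_distrib)
    have tot: "\<alpha> v + sum S (ch v) \<le> A * \<mu> v" using carleson[OF v, of "Suc n"] by (simp add: S_def)
    have mv: "0 < \<mu> v" using mu_pos[OF v] .
    have s1: "\<mu> v \<le> s" using S A by (simp add: s sum_nonneg)
    have s2: "s + \<alpha> v / A \<le> 2 * \<mu> v" using tot A by (simp add: s field_simps)
    have IH: "(\<Sum>w\<in>ch v. descent_sum ch (\<lambda>v. \<alpha> v * (J v / \<mu> v)\<^sup>2) n w)
        \<le> (\<Sum>w\<in>ch v. 4 * A * (F w - (J w)\<^sup>2 / a w))"
      unfolding a_def S_def using ch_closed[OF v] by (intro sum_mono Suc.IH)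
    also have "\<dots> = 4 * A * (F v - (\<Sum>w\<in>ch v. (J w)\<^sup>2 / a w))"
      using add(2) v by (simp add: additive_def sum_subtractf flip: sum_distrib_left)
    also have "\<dots> \<le> 4 * A * (F v - (J v)\<^sup>2 / s)"
      using sum_square_divide_ge[OF finite_ch[OF v] _ ch_nonempty[OF v], of a J] apos ch_closed[OF v] add(1) v A
      by (simp add: additive_def s_def)
    finally have 1: "(\<Sum>w\<in>ch v. descent_sum ch (\<lambda>v. \<alpha> v * (J v / \<mu> v)\<^sup>2) n w)
       \<le> 4 * A * (F v - (J v)\<^sup>2 / s)" .
    \<comment> \<open>The gain from enlarging the denominator from \<open>s\<close> to \<open>s + \<alpha> v / A\<close>; both are at most \<open>2 \<mu>\<close>.\<close>
    have x: "0 \<le> \<alpha> v / A" using \<alpha>[of v] A by simp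
    have "s * (s + \<alpha> v / A) \<le> (2 * \<mu> v) * (2 * \<mu> v)"
      using s1 s2 x mv by (intro mult_mono) linarith+
    then have "(J v)\<^sup>2 * (\<alpha> v / A) / (4 * (\<mu> v)\<^sup>2) \<le> (J v)\<^sup>2 * (\<alpha> v / A) / (s * (s + \<alpha> v / A))"
      using s1 mv x by (intro divide_left_mono mult_nonneg_nonneg mult_pos_pos) (auto simp: power2_eq_square algebra_simps)
    also have "\<dots> = (J v)\<^sup>2 / s - (J v)\<^sup>2 / (s + \<alpha> v / A)"
      using s1 mv x by (simp add: field_simps)
    finally have "4 * A * ((J v)\<^sup>2 * (\<alpha> v / A) / (4 * (\<mu> v)\<^sup>2)) \<le> 4 * A * ((J v)\<^sup>2 / s - (J v)\<^sup>2 / (s + \<alpha> v / A))"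
      using A by (intro mult_left_mono) auto
    then have 2: "\<alpha> v * (J v / \<mu> v)\<^sup>2 \<le> 4 * A * ((J v)\<^sup>2 / s - (J v)\<^sup>2 / (s + \<alpha> v / A))"
      using A by (simp add: power_divide mult.commute)
    have 3: "s + \<alpha> v / A = \<mu> v + descent_sum ch \<alpha> (Suc n) v / A"
      by (simp add: s S_def add_divide_distrib)
    show ?case using 1 2 unfolding 3[symmetric] by (simp add: algebra_simps)
  qed
  \<comment> \<open>The Bellman function divides by \<open>A\<close>, so the case \<open>A = 0\<close> is reached as a limit.\<close>
  have "descent_sum ch (\<lambda>v. \<alpha> v * (J v / \<mu> v)\<^sup>2) n v \<le> 4 * (A + e) * F v" if "0 < e" for e
  proof -
    have "descent_sum ch \<alpha> n v \<le> (A + e) * \<mu> v" if "v \<in> T" for n v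
      using carleson[OF that, of n] mu_pos[OF that] \<open>0 < e\<close> by (simp add: distrib_right add_increasing2)
    from strict[OF _ this v] A that
    have "descent_sum ch (\<lambda>v. \<alpha> v * (J v / \<mu> v)\<^sup>2) n v
      \<le> 4 * (A + e) * (F v - (J v)\<^sup>2 / (\<mu> v + descent_sum ch \<alpha> n v / (A + e)))" by simp
    also have "\<dots> \<le> 4 * (A + e) * F v"
      using A that mu_pos[OF v] descent_sum_nonneg[of \<alpha> ch n v] \<alpha> by (intro mult_left_mono) auto
    finally show ?thesis .
  qed
  then have "descent_sum ch (\<lambda>v. \<alpha> v * (J v / \<mu> v)\<^sup>2) n v \<le> 4 * A * F v + d" if "0 < d" for d
  proof (cases "F v = 0")
    case True then show ?thesis using \<open>\<And>e. 0 < e \<Longrightarrow> _ e\<close>[of 1] that by simp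
  next
    case False
    then have "0 < F v" using order_trans[OF zero_le_power2 cs[OF v]] mu_pos[OF v]
      by (simp add: zero_le_mult_iff)
    then show ?thesis using \<open>\<And>e. 0 < e \<Longrightarrow> _ e\<close>[of "d / (4 * F v)"] that by (simp add: distrib_left distrib_right)
  qed
  then show ?thesis by (rule field_le_epsilon)
qed

text \<open>With the means \<open>g = G/\<mu>\<close> and \<open>b = \<Phi>/\<mu>\<close>, the jump of \<open>G/\<Phi> = g/b\<close> from \<open>v\<close> to \<open>w\<close> is
  \<open>(g w - g v) / b w - g v (b w - b v) / (b w b v)\<close>. The first part is controlled by orthogonality of the
  martingale \<open>g\<close>. For the second, the jump energies of the bounded martingale \<open>b\<close> satisfy a Carleson
  condition with constant \<open>B\<^sup>2\<close>, so that Carleson embedding applies to them. The function \<open>J\<close> stands for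
  the integrals of the absolute value: the embedding needs an additive majorant of \<open>|G|\<close>.\<close>

lemma adapted_square_function:
  fixes G \<Phi> :: "'v \<Rightarrow> complex" and B c :: real
  assumes add: "additive G" "additive \<Phi>" "additive J" "additive F"
    and GJ: "\<And>v. v \<in> T \<Longrightarrow> cmod (G v) \<le> J v"
    and cs: "\<And>v. v \<in> T \<Longrightarrow> (J v)\<^sup>2 \<le> F v * \<mu> v"
    and upper: "\<And>v. v \<in> T \<Longrightarrow> cmod (\<Phi> v) \<le> B * \<mu> v"
    and lower: "\<And>v. v \<in> T \<Longrightarrow> c * \<mu> v \<le> cmod (\<Phi> v)" and c: "0 < c"
    and v: "v \<in> T"
  shows "descent_sum ch (jump_energy (\<lambda>v. G v / \<Phi> v)) n v \<le> (2 / c\<^sup>2 + 8 * B\<^sup>2 / c ^ 4) * F v"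
proof -
  define g where "g v = G v /\<^sub>R \<mu> v" for v
  define b where "b v = \<Phi> v /\<^sub>R \<mu> v" for v
  (* Cut off outside T, where mu may be negative, to have a weight that is nonnegative everywhere. *)
  define \<alpha> where "\<alpha> v = (if v \<in> T then jump_energy b v else 0)" for v
  have b: "c \<le> cmod (b v)" if "v \<in> T" for v
    using lower[OF that] mu_pos[OF that] by (simp add: b_def norm_mult field_simps)
  have quot: "G v / \<Phi> v = g v / b v" if "v \<in> T" for v
    using mu_pos[OF that] by (simp add: g_def b_def scaleR_conv_of_real field_simps)
  have split: "(cmod (G w / \<Phi> w - G v / \<Phi> v))\<^sup>2
      \<le> 2 / c\<^sup>2 * (cmod (g w - g v))\<^sup>2 + 2 / c ^ 4 * ((J v / \<mu> v)\<^sup>2 * (cmod (b w - b v))\<^sup>2)"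
    if w: "w \<in> T" and v: "v \<in> T" for v w
  proof -
    have nz: "b w \<noteq> 0" "b v \<noteq> 0" using b[OF w] b[OF v] c by auto
    have "G w / \<Phi> w - G v / \<Phi> v = (g w - g v) / b w - g v * (b w - b v) / (b w * b v)"
      unfolding quot[OF w] quot[OF v] using nz by (simp add: field_simps)
    also have "cmod \<dots> \<le> cmod (g w - g v) / cmod (b w) + cmod (g v) * cmod (b w - b v) / (cmod (b w) * cmod (b v))"
      by (rule norm_triangle_ineq4[THEN order_trans]) (simp add: norm_divide norm_mult)
    also have "\<dots> \<le> cmod (g w - g v) / c + (J v / \<mu> v) * cmod (b w - b v) / (c * c)"
    proof (intro add_mono frac_le mult_mono)
      show "cmod (g v) \<le> J v / \<mu> v" using GJ[OF v] mu_pos[OF v] by (simp add: g_def norm_mult divide_inverse)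
      then show "0 \<le> J v / \<mu> v" using norm_ge_zero order_trans by blast
      then show "0 \<le> J v / \<mu> v * cmod (b w - b v)" by (intro mult_nonneg_nonneg) auto
    qed (use b[OF w] b[OF v] c in auto)
    finally have "(cmod (G w / \<Phi> w - G v / \<Phi> v))\<^sup>2
        \<le> (cmod (g w - g v) / c + (J v / \<mu> v) * cmod (b w - b v) / (c * c))\<^sup>2"
      by (intro power_mono) auto
    also have "\<dots> \<le> 2 * (cmod (g w - g v) / c)\<^sup>2 + 2 * ((J v / \<mu> v) * cmod (b w - b v) / (c * c))\<^sup>2"
      using zero_le_power2[of "cmod (g w - g v) / c - (J v / \<mu> v) * cmod (b w - b v) / (c * c)"]
      unfolding power2_sum power2_diff by linarith
    finally show ?thesis by (simp add: power_divide power_mult_distrib power4_eq_xxxx power2_eq_square mult_ac)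
  qed
  have "descent_sum ch (jump_energy (\<lambda>v. G v / \<Phi> v)) n v
      \<le> descent_sum ch (\<lambda>v. 2 / c\<^sup>2 * jump_energy g v + 2 / c ^ 4 * (\<alpha> v * (J v / \<mu> v)\<^sup>2)) n v"
  proof (rule descent_sum_mono[OF v])
    fix v assume v: "v \<in> T"
    have "jump_energy (\<lambda>v. G v / \<Phi> v) v \<le> (\<Sum>w\<in>ch v. (2 / c\<^sup>2 * (cmod (g w - g v))\<^sup>2
        + 2 / c ^ 4 * ((J v / \<mu> v)\<^sup>2 * (cmod (b w - b v))\<^sup>2)) * \<mu> w)"
      unfolding jump_energy_def
      by (intro sum_mono mult_right_mono split v) (use ch_closed[OF v] mu_pos in \<open>auto intro: less_imp_le\<close>)
    also have "\<dots> = 2 / c\<^sup>2 * jump_energy g v + 2 / c ^ 4 * (\<alpha> v * (J v / \<mu> v)\<^sup>2)"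
      using v by (simp add: \<alpha>_def jump_energy_def sum_distrib_left sum_distrib_right sum.distrib algebra_simps)
    finally show "jump_energy (\<lambda>v. G v / \<Phi> v) v \<le> \<dots>" .
  qed
  also have "\<dots> = 2 / c\<^sup>2 * descent_sum ch (jump_energy g) n v
      + 2 / c ^ 4 * descent_sum ch (\<lambda>v. \<alpha> v * (J v / \<mu> v)\<^sup>2) n v"
    by (rule descent_sum_lincomb)
  also have "\<dots> \<le> 2 / c\<^sup>2 * F v + 2 / c ^ 4 * (4 * B\<^sup>2 * F v)"
  proof (intro add_mono mult_left_mono)
    have "descent_sum ch (jump_energy g) n v \<le> F v - (cmod (G v))\<^sup>2 / \<mu> v"
      unfolding g_def
    proof (rule martingale_square_function[OF add(1,4) _ v])
      fix v assume v: "v \<in> T"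
      show "(cmod (G v))\<^sup>2 \<le> F v * \<mu> v" using GJ[OF v] cs[OF v] power_mono[OF GJ[OF v], of 2] by simp
    qed
    then show "descent_sum ch (jump_energy g) n v \<le> F v"
      using divide_nonneg_pos[OF zero_le_power2 mu_pos[OF v], of "cmod (G v)"] by linarith
    show "descent_sum ch (\<lambda>v. \<alpha> v * (J v / \<mu> v)\<^sup>2) n v \<le> 4 * B\<^sup>2 * F v"
    proof (rule carleson_embedding[OF add(3,4) cs _ _ _ v])
      show "0 \<le> \<alpha> v" for v
        using ch_closed by (auto simp: \<alpha>_def jump_energy_def intro!: sum_nonneg mult_nonneg_nonneg less_imp_le[OF mu_pos])
      fix n v assume v: "v \<in> T"
      have "descent_sum ch \<alpha> n v \<le> descent_sum ch (jump_energy b) n v"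
        by (rule descent_sum_mono[OF v]) (simp add: \<alpha>_def)
      also have "\<dots> \<le> B\<^sup>2 * \<mu> v - (cmod (\<Phi> v))\<^sup>2 / \<mu> v"
        unfolding b_def
      proof (rule martingale_square_function[OF add(2) _ _ v])
        show "additive (\<lambda>v. B\<^sup>2 * \<mu> v)" using mu_additive by (simp add: additive_def flip: sum_distrib_left)
        show "(cmod (\<Phi> v))\<^sup>2 \<le> B\<^sup>2 * \<mu> v * \<mu> v" if "v \<in> T" for v
          using power_mono[OF upper[OF that] norm_ge_zero, of 2] by (simp add: power_mult_distrib power2_eq_square mult_ac)
      qed
      finally show "descent_sum ch \<alpha> n v \<le> B\<^sup>2 * \<mu> v"
        using divide_nonneg_pos[OF zero_le_power2 mu_pos[OF v], of "cmod (\<Phi> v)"] by linarith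
    qed (assumption, rule zero_le_power2)
  qed (use c in simp_all)
  finally show ?thesis by (simp add: distrib_right)
qed

end

section \<open>Geometry of dyadic grids\<close>

definition grid_shift :: "(int \<Rightarrow> real^'m) \<Rightarrow> int \<Rightarrow> real^'m" where
  "grid_shift \<omega> q = (\<Sum>\<^sub>\<infinity>i\<in>{q<..}. 2 powi (- i) *\<^sub>R \<omega> i)"

text \<open>The cube with integer coordinates \<open>k\<close> among those of side \<open>2 powi (- q)\<close> in the shifted grid. All
  questions on inclusion and disjointness are settled on the coordinates, where they concern floors.\<close>

definition grid_cube :: "(int \<Rightarrow> real^'m) \<Rightarrow> int \<Rightarrow> ('m \<Rightarrow> int) \<Rightarrow> (real^'m) set" where
  "grid_cube \<omega> q k = cube ((\<chi> i. 2 powi (- q) * real_of_int (k i)) + grid_shift \<omega> q) (2 powi (- q))"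

definition grid_coord :: "(int \<Rightarrow> real^'m) \<Rightarrow> int \<Rightarrow> real^'m \<Rightarrow> 'm \<Rightarrow> int" where
  "grid_coord \<omega> q x i = \<lfloor>(x $ i - grid_shift \<omega> q $ i) * 2 powi q\<rfloor>"

lemma two_powi_pos: "0 < (2::real) powi q"
  by simp

lemma two_powi_minus_less_iff: "(2::real) powi (- i) < 2 powi (- q) \<longleftrightarrow> q < i"
proof -
  have *: "(2::real) powi (- i) < 2 powi (- q)" if "q < i" for q i :: int
    using that by (intro power_int_strict_increasing) auto
  show ?thesis using *[of q i] *[of i q] by (cases i q rule: linorder_cases) auto
qed

lemma two_powi_minus_succ: "(2::real) powi (- (q + 1)) = 2 powi (- q) / 2"
proof -
  have "(2::real) powi (- q + - 1) = 2 powi (- q) * 2 powi (- 1)" by (rule power_int_add) simp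
  moreover have "(2::real) powi (- 1) = 1 / 2" by (simp add: power_int_def)
  moreover have "- (q + 1) = - q + - 1" by simp
  ultimately show ?thesis by simp
qed

lemma two_powi_minus_inj: "(2::real) powi (- i) = 2 powi (- q) \<Longrightarrow> i = q"
  using two_powi_minus_less_iff[of i q] two_powi_minus_less_iff[of q i]
  by (cases i q rule: linorder_cases) auto

lemma translate_cube: "(\<lambda>x. x + s) ` cube p l = cube (p + s) l"
proof -
  have "x \<in> (\<lambda>x. x + s) ` cube p l" if "x \<in> cube (p + s) l" for x
    using that by (intro image_eqI[of _ _ "x - s"]) (auto simp: cube_def algebra_simps)
  then show ?thesis by (auto simp: cube_def algebra_simps)
qed

lemma shifted_grid_eq: "shifted_grid \<omega> = {grid_cube \<omega> q k | q k. True}"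
proof -
  have *: "(\<lambda>x. x + (\<Sum>\<^sub>\<infinity>i\<in>{i::int. 2 powi (- i) < side I}. 2 powi (- i) *\<^sub>R \<omega> i)) ` I = grid_cube \<omega> q k"
    if "I = cube (\<chi> i. 2 powi (- q) * real_of_int (k i)) (2 powi (- q))" for I q k
    by (simp add: that side_cube two_powi_pos two_powi_minus_less_iff translate_cube grid_cube_def
        grid_shift_def greaterThan_def del: power_int_minus)
  show ?thesis
    unfolding shifted_grid_def standard_grid_def using * by blast
qed

lemma summable_shifts:
  fixes \<omega> :: "int \<Rightarrow> real^'m"
  assumes "\<forall>i k. \<omega> i $ k \<in> {0, 1}"
  shows "(\<lambda>i. 2 powi (- i) *\<^sub>R \<omega> i) summable_on {q<..}"
proof (rule abs_summable_summable, rule Infinite_Sum.abs_summable_on_comparison_test)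
  have "summable (\<lambda>n. (1/2::real) ^ n)" by (simp add: summable_geometric)
  then have "(\<lambda>n. (1/2::real) ^ n) summable_on UNIV"
    by (intro norm_summable_imp_summable_on) simp
  then have "(\<lambda>n. (2 powi (- q - 1) * real CARD('m)) * (1/2::real) ^ n) summable_on UNIV"
    by (rule summable_on_cmult_right)
  also have "(\<lambda>n. (2 powi (- q - 1) * real CARD('m)) * (1/2::real) ^ n)
      = (\<lambda>n. (\<lambda>i. real CARD('m) * 2 powi (- i)) (q + 1 + int n))"
  proof
    fix n
    have "(2::real) powi (- (q + 1 + int n)) = 2 powi ((- q - 1) + (- int n))"
      by (rule arg_cong[of _ _ "\<lambda>k. 2 powi k"]) simp
    also have "\<dots> = 2 powi (- q - 1) * 2 powi (- int n)" by (rule power_int_add) simp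
    also have "(2::real) powi (- int n) = (1/2) ^ n"
      by (simp add: power_int_minus power_one_over inverse_eq_divide)
    finally show "(2 powi (- q - 1) * real CARD('m)) * (1/2::real) ^ n
      = (\<lambda>i. real CARD('m) * 2 powi (- i)) (q + 1 + int n)" by (simp add: mult_ac)
  qed
  also have "\<dots> summable_on UNIV \<longleftrightarrow> (\<lambda>i. real CARD('m) * 2 powi (- i)) summable_on {q<..}"
    by (rule summable_on_reindex_bij_betw, rule bij_betwI[of _ _ _ "\<lambda>i. nat (i - q - 1)"]) auto
  finally show "(\<lambda>i. norm (real CARD('m) * 2 powi (- i))) summable_on {q<..}" by (simp add: abs_mult)
  fix i :: int
  have "norm (\<omega> i) \<le> (\<Sum>k\<in>UNIV. \<bar>\<omega> i $ k\<bar>)" by (rule norm_le_l1_cart)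
  also have "\<dots> \<le> (\<Sum>k\<in>(UNIV::'m set). 1)"
    using assms by (intro sum_mono) (metis abs_0 abs_1 empty_iff insert_iff order_refl zero_le_one)
  finally show "norm (2 powi (- i) *\<^sub>R \<omega> i) \<le> norm (real CARD('m) * 2 powi (- i))"
    by (simp add: abs_mult mult_ac mult_left_mono)
qed

lemma grid_shift_step:
  fixes \<omega> :: "int \<Rightarrow> real^'m"
  assumes "\<forall>i k. \<omega> i $ k \<in> {0, 1}"
  shows "grid_shift \<omega> q = 2 powi (- (q + 1)) *\<^sub>R \<omega> (q + 1) + grid_shift \<omega> (q + 1)"
proof -
  have "{q<..} = insert (q + 1) {q + 1<..}" by auto
  then show ?thesis
    unfolding grid_shift_def using summable_shifts[OF assms, of "q + 1"] by (simp add: infsum_insert del: power_int_minus)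
qed

lemma mem_grid_cube: "x \<in> grid_cube \<omega> q k \<longleftrightarrow> grid_coord \<omega> q x = k"
proof -
  have P: "(2::real) powi (- q) = 1 / 2 powi q" by (simp add: power_int_minus divide_inverse)
  have "(2 powi (- q) * real_of_int (k i) + s \<le> y \<and> y < 2 powi (- q) * real_of_int (k i) + s + 2 powi (- q))
      \<longleftrightarrow> \<lfloor>(y - s) * 2 powi q\<rfloor> = k i" for i y s
    unfolding P floor_eq_iff using two_powi_pos[of q] by (simp add: field_simps)
  then show ?thesis
    by (simp add: grid_cube_def cube_def grid_coord_def fun_eq_iff)
qed

text \<open>Refining the grid by one level shifts the coarse lattice by half its mesh in the directions where
  \<open>\<omega> (q + 1)\<close> is 1. The coarse coordinates are thus a function of the fine ones, which is nestedness.\<close>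

lemma grid_coord_parent:
  fixes \<omega> :: "int \<Rightarrow> real^'m"
  assumes "\<forall>i k. \<omega> i $ k \<in> {0, 1}"
  shows "grid_coord \<omega> q x i = (grid_coord \<omega> (q + 1) x i - \<lfloor>\<omega> (q + 1) $ i\<rfloor>) div 2"
proof -
  define y where "y = (x $ i - grid_shift \<omega> (q + 1) $ i) * 2 powi (q + 1)"
  define w where "w = \<lfloor>\<omega> (q + 1) $ i\<rfloor>"
  have "\<omega> (q + 1) $ i \<in> {0, 1}" using assms by blast
  then have w: "\<omega> (q + 1) $ i = real_of_int w" by (auto simp: w_def)
  have p: "(2::real) powi (q + 1) = 2 * 2 powi q" by (simp add: power_int_add_1')
  have pm: "(2::real) powi (- (q + 1)) = 1 / (2 * 2 powi q)"
    by (metis p power_int_minus inverse_eq_divide)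
  have "(x $ i - grid_shift \<omega> q $ i) * 2 powi q = (y - real_of_int w) / real_of_int 2"
    unfolding grid_shift_step[OF assms, of q] y_def p pm using w two_powi_pos[of q]
    by (simp add: field_simps)
  then have "grid_coord \<omega> q x i = \<lfloor>y - real_of_int w\<rfloor> div 2"
    unfolding grid_coord_def by (metis floor_divide_real_eq_div zero_le_numeral)
  then show ?thesis by (simp add: grid_coord_def y_def w_def)
qed

lemma grid_cube_nonempty: "\<exists>x. x \<in> grid_cube \<omega> q k"
  unfolding grid_cube_def using cube_lower_corner two_powi_pos by blast

lemma side_grid_cube: "side (grid_cube \<omega> q k) = 2 powi (- q)"
  unfolding grid_cube_def by (rule side_cube) (rule two_powi_pos)

lemma grid_level_shifted: "grid_level (shifted_grid \<omega>) q = range (grid_cube \<omega> q)"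
  unfolding grid_level_def shifted_grid_eq using two_powi_minus_inj
  by (fastforce simp: side_grid_cube simp del: power_int_minus)

text \<open>Positivity comes from the open box inside the cube, finiteness from the closed box around it.\<close>

lemma measure_cube:
  assumes "0 < l"
  shows "cube p l \<in> lmeasurable" "0 < measure lebesgue (cube p l)"
proof -
  have sub: "cube p l \<subseteq> cbox p (\<chi> i. p $ i + l)"
    by (auto simp: cube_def mem_box_cart less_imp_le)
  have sup: "box p (\<chi> i. p $ i + l) \<subseteq> cube p l"
    by (auto simp: cube_def mem_box_cart less_imp_le)
  have "cube p l = (\<Inter>i. {x. p $ i \<le> x $ i} \<inter> {x. x $ i < p $ i + l})" by (auto simp: cube_def)
  also have "\<dots> \<in> sets borel" by (intro sets.countable_INT'') measurable
  finally have "cube p l \<in> sets lebesgue" by simp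
  then show lm: "cube p l \<in> lmeasurable" using sub
    by (rule_tac fmeasurableI2[of "cbox p (\<chi> i. p $ i + l)"]) auto
  have "\<not> negligible (box p (\<chi> i. p $ i + l))"
    using assms by (intro open_not_negligible) (auto simp: interval_ne_empty_cart)
  then have "\<not> negligible (cube p l)" using sup negligible_subset by blast
  then show "0 < measure lebesgue (cube p l)"
    using lm negligible_iff_measure0 by (metis negligible_iff_measure zero_less_measure_iff)
qed

definition children :: "(real^'m) set set \<Rightarrow> (real^'m) set \<Rightarrow> (real^'m) set set" where
  "children D V = {W \<in> D. W \<subseteq> V \<and> side W = side V / 2}"

locale dyadic =
  fixes D :: "(real^'m) set set"
  assumes dyadic: "dyadic_grid D"
begin

lemma dyadicE:
  obtains \<omega> where "\<forall>i k. \<omega> i $ k \<in> {0, 1}" "D = shifted_grid \<omega>" "\<And>q. grid_level D q = range (grid_cube \<omega> q)"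
  using dyadic grid_level_shifted unfolding dyadic_grid_def by blast

lemma in_level: "V \<in> D \<Longrightarrow> \<exists>q. V \<in> grid_level D q"
  by (rule dyadicE) (auto simp: shifted_grid_eq)

lemma level_in: "V \<in> grid_level D q \<Longrightarrow> V \<in> D"
  by (simp add: grid_level_def)

lemma level_unique: "V \<in> grid_level D q \<Longrightarrow> V \<in> grid_level D r \<Longrightarrow> q = r"
  using two_powi_minus_inj by (simp add: grid_level_def del: power_int_minus)

lemma the_level: "V \<in> grid_level D q \<Longrightarrow> (THE q. V \<in> grid_level D q) = q"
  using level_unique by blast

lemma level_is_cube: "V \<in> grid_level D q \<Longrightarrow> \<exists>p. V = cube p (2 powi (- q))"
  by (rule dyadicE) (auto simp: grid_cube_def)

lemma in_cubes: "V \<in> D \<Longrightarrow> V \<in> cubes"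
  using in_level level_is_cube two_powi_pos unfolding cubes_def by blast

lemma lmeasurable: "V \<in> D \<Longrightarrow> V \<in> lmeasurable"
  and measure_pos: "V \<in> D \<Longrightarrow> 0 < measure lebesgue V"
  using in_cubes[of V] measure_cube unfolding cubes_def by blast+

lemma countable_grid: "countable D"
proof (rule dyadicE)
  fix \<omega> assume "D = shifted_grid \<omega>"
  then have "D = (\<lambda>(q, k). grid_cube \<omega> q k) ` UNIV" by (auto simp: shifted_grid_eq)
  then show ?thesis by (metis countable_image countableI_type)
qed

lemma level_covers: "\<exists>V\<in>grid_level D q. x \<in> V"
  by (rule dyadicE) (metis mem_grid_cube rangeI)

lemma level_disjoint: "V \<in> grid_level D q \<Longrightarrow> W \<in> grid_level D q \<Longrightarrow> x \<in> V \<Longrightarrow> x \<in> W \<Longrightarrow> V = W"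
  by (rule dyadicE) (auto simp: mem_grid_cube)

lemma level_parent: "V \<in> grid_level D (q + 1) \<Longrightarrow> \<exists>W\<in>grid_level D q. V \<subseteq> W"
proof (rule dyadicE)
  fix \<omega> assume V: "V \<in> grid_level D (q + 1)"
    and w: "\<forall>i k. \<omega> i $ k \<in> {0, 1}" and L: "\<And>q. grid_level D q = range (grid_cube \<omega> q)"
  from V obtain k where k: "V = grid_cube \<omega> (q + 1) k" by (auto simp: L)
  have "V \<subseteq> grid_cube \<omega> q (\<lambda>i. (k i - \<lfloor>\<omega> (q + 1) $ i\<rfloor>) div 2)"
    using grid_coord_parent[OF w, of q] by (auto simp: k mem_grid_cube fun_eq_iff)
  then show ?thesis by (auto simp: L)
qed

lemma children_level: "V \<in> grid_level D q \<Longrightarrow> children D V = {W \<in> grid_level D (q + 1). W \<subseteq> V}"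
proof -
  assume "V \<in> grid_level D q"
  then have "side V / 2 = 2 powi (- (q + 1))"
    unfolding two_powi_minus_succ by (simp add: grid_level_def)
  then show ?thesis by (auto simp: children_def grid_level_def simp del: power_int_minus)
qed

text \<open>By the formula for the parent's coordinates, each coordinate of a child takes one of two values.\<close>

lemma finite_children: "V \<in> D \<Longrightarrow> finite (children D V)"
proof (rule dyadicE)
  assume "V \<in> D"
  then obtain q where V: "V \<in> grid_level D q" by (auto dest: in_level)
  fix \<omega>
  assume w: "\<forall>i k. \<omega> i $ k \<in> {0, 1}" and L: "\<And>q. grid_level D q = range (grid_cube \<omega> q)"
  from V obtain K where K: "V = grid_cube \<omega> q K" by (auto simp: L)
  define A where "A i = {2 * K i + \<lfloor>\<omega> (q + 1) $ i\<rfloor> .. 2 * K i + \<lfloor>\<omega> (q + 1) $ i\<rfloor> + 1}" for i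
  have "children D V \<subseteq> grid_cube \<omega> (q + 1) ` (Pi\<^sub>E UNIV A)"
  proof
    fix W assume "W \<in> children D V"
    then obtain k where k: "W = grid_cube \<omega> (q + 1) k" "W \<subseteq> V"
      unfolding children_level[OF V] L by auto
    obtain x where "x \<in> W" using grid_cube_nonempty k by blast
    then have "grid_coord \<omega> (q + 1) x = k" "grid_coord \<omega> q x = K"
      using k K by (auto simp: mem_grid_cube)
    then have "K i = (k i - \<lfloor>\<omega> (q + 1) $ i\<rfloor>) div 2" for i
      using grid_coord_parent[OF w, of q x i] by simp
    then have "k i \<in> A i" for i
      unfolding A_def atLeastAtMost_iff by presburger
    then show "W \<in> grid_cube \<omega> (q + 1) ` (Pi\<^sub>E UNIV A)" using k by auto
  qed
  moreover have "finite (Pi\<^sub>E UNIV A)" by (intro finite_PiE) (auto simp: A_def)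
  ultimately show ?thesis using finite_surj by blast
qed

lemma children_subset: "W \<in> children D V \<Longrightarrow> W \<subseteq> V"
  and children_in: "W \<in> children D V \<Longrightarrow> W \<in> D"
  by (auto simp: children_def)

lemma children_disjoint: "V \<in> D \<Longrightarrow> disjoint (children D V)"
proof (rule pairwiseI)
  fix X Y assume "V \<in> D" and XY: "X \<in> children D V" "Y \<in> children D V" "X \<noteq> Y"
  then obtain q where V: "V \<in> grid_level D q" by (auto dest: in_level)
  have "X \<in> grid_level D (q + 1)" "Y \<in> grid_level D (q + 1)"
    using XY unfolding children_level[OF V] by auto
  then show "disjnt X Y" using level_disjoint[of X "q + 1" Y] XY by (auto simp: disjnt_def)
qed

lemma Union_children: "V \<in> D \<Longrightarrow> \<Union>(children D V) = V"
proof -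
  assume "V \<in> D"
  then obtain q where V: "V \<in> grid_level D q" by (auto dest: in_level)
  have "x \<in> \<Union>(children D V)" if "x \<in> V" for x
  proof -
    obtain W where W: "W \<in> grid_level D (q + 1)" "x \<in> W" using level_covers by blast
    then obtain P where "P \<in> grid_level D q" "W \<subseteq> P" using level_parent by blast
    then have "W \<subseteq> V" using level_disjoint[OF V, of P x] W \<open>x \<in> V\<close> by blast
    then show ?thesis using W children_level[OF V] by blast
  qed
  then show ?thesis using children_subset by blast
qed

lemma ancestor: "V \<in> grid_level D (q + int n) \<Longrightarrow> \<exists>W\<in>grid_level D q. V \<in> generation (children D) n W"
proof (induction n arbitrary: q)
  case 0 then show ?case by auto
next
  case (Suc n)
  then have "V \<in> grid_level D ((q + 1) + int n)" by (simp add: algebra_simps)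
  then obtain W where W: "W \<in> grid_level D (q + 1)" "V \<in> generation (children D) n W" using Suc.IH by blast
  obtain P where P: "P \<in> grid_level D q" "W \<subseteq> P" using level_parent[OF W(1)] by blast
  then have "W \<in> children D P" using children_level W by blast
  then show ?case using P W by auto
qed

lemma set_integral_children:
  fixes u :: "real^'m \<Rightarrow> 'b::{banach,second_countable_topology}"
  assumes V: "V \<in> D" and u: "set_integrable lebesgue V u"
  shows "(\<Sum>W\<in>children D V. LINT x:W|lebesgue. u x) = (LINT x:V|lebesgue. u x)"
proof -
  have "(LINT x:\<Union>(children D V)|lebesgue. u x) = (\<Sum>W\<in>children D V. LINT x:W|lebesgue. u x)"
  proof (rule set_integral_finite_Union[where A = "\<lambda>W. W", unfolded image_ident])
    show "finite (children D V)" "disjoint_family_on (\<lambda>W. W) (children D V)"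
      using V finite_children children_disjoint[OF V] by (auto simp: disjoint_family_on_def pairwise_def disjnt_def)
  next
    fix W assume W: "W \<in> children D V"
    show "W \<in> sets lebesgue" using lmeasurable[OF children_in[OF W]] by simp
    then show "set_integrable lebesgue W u"
      using set_integrable_subset[OF u] children_subset[OF W] by blast
  qed
  then show ?thesis using Union_children[OF V] by simp
qed

lemma measure_children: "V \<in> D \<Longrightarrow> (\<Sum>W\<in>children D V. measure lebesgue W) = measure lebesgue V"
  using measure_Union'[OF finite_children _ children_disjoint, of V] Union_children[of V] lmeasurable children_in
  by (metis)

lemma measured_tree_grid: "measured_tree D (children D) (measure lebesgue)"
  by unfold_locales (simp_all add: finite_children children_in measure_pos measure_children)

text \<open>Functions of bounded mean oscillation minus their mean on a cube are controlled on that cube only, so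
  the estimates on trees are needed for the tree of subcubes of a single cube.\<close>

lemma measured_tree_below: "measured_tree {W \<in> D. W \<subseteq> V} (children D) (measure lebesgue)"
  using children_subset by unfold_locales (auto simp add: finite_children children_in measure_pos measure_children)

end

section \<open>Square-integrable functions\<close>

text \<open>Cauchy-Schwarz, from the quadratic polynomial \<open>t \<mapsto> \<integral> (u - t v)\<^sup>2\<close> being nonnegative. If its leading
  coefficient is zero, it can only be bounded below when it is constant.\<close>

lemma integral_mult_square_le:
  fixes u v :: "'a \<Rightarrow> real"
  assumes [measurable]: "u \<in> borel_measurable M" "v \<in> borel_measurable M"
    and u: "integrable M (\<lambda>x. (u x)\<^sup>2)" and v: "integrable M (\<lambda>x. (v x)\<^sup>2)"
  shows "integrable M (\<lambda>x. u x * v x)"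
    and "(LINT x|M. u x * v x)\<^sup>2 \<le> (LINT x|M. (u x)\<^sup>2) * (LINT x|M. (v x)\<^sup>2)"
proof -
  show uv: "integrable M (\<lambda>x. u x * v x)"
  proof (rule Bochner_Integration.integrable_bound[OF Bochner_Integration.integrable_add[OF u v]])
    show "(\<lambda>x. u x * v x) \<in> borel_measurable M" by measurable
    have "\<bar>u x * v x\<bar> \<le> (u x)\<^sup>2 + (v x)\<^sup>2" for x
    proof -
      have "2 * (\<bar>u x\<bar> * \<bar>v x\<bar>) \<le> (u x)\<^sup>2 + (v x)\<^sup>2"
        using sum_squares_bound[of "\<bar>u x\<bar>" "\<bar>v x\<bar>"] by (simp add: mult.assoc)
      moreover have "0 \<le> \<bar>u x\<bar> * \<bar>v x\<bar>" by simp
      ultimately show ?thesis unfolding abs_mult by linarith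
    qed
    then show "AE x in M. norm (u x * v x) \<le> norm ((u x)\<^sup>2 + (v x)\<^sup>2)" by simp
  qed
  define A where "A = (LINT x|M. (u x)\<^sup>2)"
  define B where "B = (LINT x|M. (v x)\<^sup>2)"
  define c where "c = (LINT x|M. u x * v x)"
  have quad: "0 \<le> A - 2 * t * c + t\<^sup>2 * B" for t
  proof -
    have "0 \<le> (LINT x|M. (u x - t * v x)\<^sup>2)" by simp
    also have "\<dots> = (LINT x|M. (u x)\<^sup>2 - 2 * t * (u x * v x) + t\<^sup>2 * (v x)\<^sup>2)"
      by (intro Bochner_Integration.integral_cong refl) (simp add: power2_eq_square algebra_simps)
    also have "\<dots> = A - 2 * t * c + t\<^sup>2 * B"
      using u v uv by (simp add: A_def B_def c_def)
    finally show ?thesis .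
  qed
  have "0 \<le> B" by (simp add: B_def)
  show "c\<^sup>2 \<le> A * B"
  proof (cases "B = 0")
    case True
    show ?thesis
    proof (cases "c = 0")
      case False
      then show ?thesis using quad[of "(A + 1) / (2 * c)"] True by simp
    qed (simp add: True)
  next
    case False
    then have "0 < B" using \<open>0 \<le> B\<close> by simp
    have "A - 2 * (c / B) * c + (c / B)\<^sup>2 * B = A - c\<^sup>2 / B"
      using False by (simp add: power2_eq_square)
    then have "c\<^sup>2 / B \<le> A" using quad[of "c / B"] by simp
    then show ?thesis using \<open>0 < B\<close> by (simp add: pos_divide_le_eq)
  qed
qed

lemma L2_measurable: "f \<in> L2 \<Longrightarrow> f \<in> borel_measurable lebesgue"
  and L2_integrable: "f \<in> L2 \<Longrightarrow> integrable lebesgue (\<lambda>x. (cmod (f x))\<^sup>2)"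
  by (simp_all add: L2_def)

lemma L2_norm_square: "(L2_norm f)\<^sup>2 = (LINT x|lebesgue. (cmod (f x))\<^sup>2)"
  by (simp add: L2_norm_def)

lemma L2_norm_nonneg: "0 \<le> L2_norm f"
  by (simp add: L2_norm_def)

lemma L2_dominated:
  assumes "f \<in> borel_measurable lebesgue" "integrable lebesgue w"
    and "AE x in lebesgue. (cmod (f x))\<^sup>2 \<le> w x"
  shows "f \<in> L2"
proof -
  note [measurable] = assms(1)
  have "(\<lambda>x. (cmod (f x))\<^sup>2) \<in> borel_measurable lebesgue" by measurable
  then have "integrable lebesgue (\<lambda>x. (cmod (f x))\<^sup>2)"
  proof (rule Bochner_Integration.integrable_bound[OF assms(2)])
    show "AE x in lebesgue. norm ((cmod (f x))\<^sup>2) \<le> norm (w x)"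
      using assms(3) by eventually_elim simp
  qed
  then show ?thesis using assms(1) by (simp add: L2_def)
qed

lemma L2_diff: "f \<in> L2 \<Longrightarrow> g \<in> L2 \<Longrightarrow> (\<lambda>x. f x - g x) \<in> L2"
proof (rule L2_dominated)
  assume fg: "f \<in> L2" "g \<in> L2"
  then show "(\<lambda>x. f x - g x) \<in> borel_measurable lebesgue"
    by (intro borel_measurable_diff L2_measurable)
  show "integrable lebesgue (\<lambda>x. 2 * (cmod (f x))\<^sup>2 + 2 * (cmod (g x))\<^sup>2)"
    using fg L2_integrable by (intro Bochner_Integration.integrable_add integrable_mult_right) auto
  show "AE x in lebesgue. (cmod (f x - g x))\<^sup>2 \<le> 2 * (cmod (f x))\<^sup>2 + 2 * (cmod (g x))\<^sup>2"
  proof (rule AE_I2)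
    fix x
    have "(cmod (f x - g x))\<^sup>2 \<le> (cmod (f x) + cmod (g x))\<^sup>2"
      by (intro power_mono norm_triangle_ineq4) simp
    also have "\<dots> \<le> 2 * (cmod (f x))\<^sup>2 + 2 * (cmod (g x))\<^sup>2"
      using zero_le_power2[of "cmod (f x) - cmod (g x)"] unfolding power2_sum power2_diff by linarith
    finally show "(cmod (f x - g x))\<^sup>2 \<le> 2 * (cmod (f x))\<^sup>2 + 2 * (cmod (g x))\<^sup>2" .
  qed
qed

lemma L2_zero: "(\<lambda>x. 0) \<in> L2"
  by (simp add: L2_def)

lemma L2_minus: "f \<in> L2 \<Longrightarrow> (\<lambda>x. - f x) \<in> L2"
  using L2_diff[OF L2_zero, of f] by simp

lemma L2_cnj:
  assumes "f \<in> L2"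
  shows "(\<lambda>x. cnj (f x)) \<in> L2"
proof (rule L2_dominated[OF _ L2_integrable[OF assms]])
  have "cnj \<in> borel_measurable borel"
    by (intro borel_measurable_continuous_onI continuous_on_cnj continuous_on_id)
  then show "(\<lambda>x. cnj (f x)) \<in> borel_measurable lebesgue"
    by (rule measurable_compose[OF L2_measurable[OF assms]])
qed simp

lemma L2_sum: "(\<And>V. V \<in> F \<Longrightarrow> H V \<in> L2) \<Longrightarrow> (\<lambda>x. \<Sum>V\<in>F. H V x) \<in> L2"
proof (induction F rule: infinite_finite_induct)
  case (insert V F)
  then have "(\<lambda>x. H V x - - (\<Sum>V\<in>F. H V x)) \<in> L2" by (intro L2_diff L2_minus) auto
  then show ?case using insert by simp
qed (simp_all add: L2_zero)

lemma pairing_integrable: "f \<in> L2 \<Longrightarrow> g \<in> L2 \<Longrightarrow> integrable lebesgue (\<lambda>x. f x * g x)"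
  and pairing_le: "f \<in> L2 \<Longrightarrow> g \<in> L2 \<Longrightarrow> cmod (pairing f g) \<le> L2_norm f * L2_norm g"
proof -
  assume fg: "f \<in> L2" "g \<in> L2"
  note [measurable] = fg[THEN L2_measurable]
  note cs = integral_mult_square_le[of "\<lambda>x. cmod (f x)" lebesgue "\<lambda>x. cmod (g x)", OF _ _ fg[THEN L2_integrable]]
  show i: "integrable lebesgue (\<lambda>x. f x * g x)"
    by (rule Bochner_Integration.integrable_bound[OF cs(1)]) (simp_all add: norm_mult)
  have "cmod (pairing f g) \<le> (LINT x|lebesgue. cmod (f x) * cmod (g x))"
    unfolding pairing_def norm_mult[symmetric] by (rule integral_norm_bound)
  also have "\<dots> \<le> L2_norm f * L2_norm g"
  proof (rule power2_le_imp_le)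
    show "(LINT x|lebesgue. cmod (f x) * cmod (g x))\<^sup>2 \<le> (L2_norm f * L2_norm g)\<^sup>2"
      unfolding power_mult_distrib L2_norm_square by (rule cs(2)) measurable
  qed (intro mult_nonneg_nonneg L2_norm_nonneg)
  finally show "cmod (pairing f g) \<le> L2_norm f * L2_norm g" .
qed

lemma pairing_sum:
  assumes "\<And>V. V \<in> F \<Longrightarrow> H V \<in> L2" "g \<in> L2"
  shows "pairing (\<lambda>x. \<Sum>V\<in>F. H V x) g = (\<Sum>V\<in>F. pairing (H V) g)"
  unfolding pairing_def sum_distrib_right
  by (rule Bochner_Integration.integral_sum) (rule pairing_integrable[OF assms])

lemma pairing_diff:
  assumes "f \<in> L2" "h \<in> L2" "g \<in> L2"
  shows "pairing (\<lambda>x. f x - h x) g = pairing f g - pairing h g"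
  unfolding pairing_def left_diff_distrib
  by (rule Bochner_Integration.integral_diff) (rule pairing_integrable, rule assms, rule assms)+

text \<open>This is the argument of the Riesz-Fischer theorem. Choose an increasing sequence \<open>F n\<close> of finite sets
  exhausting \<open>D\<close> outside of which \<open>s\<close> has mass at most \<open>(1/4) ^ n\<close>, so that the increments \<open>u n\<close> of
  the partial sums have squared norm at most \<open>K (1/4) ^ n\<close>. Then \<open>\<Sum>n. 2 ^ n |u n|\<^sup>2\<close> is integrable, hence
  finite almost everywhere, and the partial sums converge there to some \<open>h\<close>. Fatou's lemma carries
  the bounds for differences of partial sums over to \<open>h\<close>, and gives convergence in norm over the net
  of all finite subsets.\<close>

lemma L2_unconditional_series:
  fixes H :: "'v \<Rightarrow> real^'m \<Rightarrow> complex" and s :: "'v \<Rightarrow> real"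
  assumes countable: "countable D"
    and H: "\<And>V. V \<in> D \<Longrightarrow> H V \<in> L2"
    and s: "\<And>V. V \<in> D \<Longrightarrow> 0 \<le> s V" "s summable_on D" and K: "0 \<le> K"
    and bound: "\<And>F. finite F \<Longrightarrow> F \<subseteq> D \<Longrightarrow> (L2_norm (\<lambda>x. \<Sum>V\<in>F. H V x))\<^sup>2 \<le> K * sum s F"
  shows "\<exists>h\<in>L2. (L2_norm h)\<^sup>2 \<le> K * infsum s D \<and>
    (\<forall>g\<in>L2. ((\<lambda>V. pairing (H V) g) has_sum pairing h g) D)"
proof (cases "D = {}")
  case True
  have "L2_norm (\<lambda>x::real^'m. 0) = 0" unfolding L2_norm_def by simp
  then show ?thesis using True by (intro bexI[OF _ L2_zero]) (simp add: pairing_def)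
next
  case False
  define tot where "tot = infsum s D"
  have le_tot: "sum s F \<le> tot" if "finite F" "F \<subseteq> D" for F
    unfolding tot_def using s that by (intro finite_sum_le_infsum) auto
  have lim: "(sum s \<longlongrightarrow> tot) (finite_subsets_at_top D)"
    using has_sum_infsum[OF s(2)] by (simp add: tot_def has_sum_def)
  have "\<exists>X. finite X \<and> X \<subseteq> D \<and> tot - sum s X \<le> (1/4) ^ n" for n :: nat
  proof -
    have "tot - (1/4) ^ n < tot" by simp
    then have "\<forall>\<^sub>F X in finite_subsets_at_top D. tot - (1/4) ^ n < sum s X"
      using lim by (metis order_tendstoD(1))
    then show ?thesis unfolding eventually_finite_subsets_at_top by force
  qed
  then obtain X where X: "\<And>n. finite (X n)" "\<And>n. X n \<subseteq> D" "\<And>n. tot - sum s (X n) \<le> (1/4) ^ n"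
    by metis
  define F where "F n = (\<Union>k\<le>n. insert (from_nat_into D k) (X k))" for n
  have F: "finite (F n)" "F n \<subseteq> D" for n
    using X from_nat_into[OF False] by (auto simp: F_def)
  have F_mono: "F m \<subseteq> F n" if "m \<le> n" for m n
    using that by (force simp: F_def)
  have tail: "tot - sum s (F n) \<le> (1/4) ^ n" for n
  proof -
    have "sum s (X n) \<le> sum s (F n)"
    proof (rule sum_mono2)
      show "X n \<subseteq> F n" by (auto simp: F_def)
    qed (use F s in blast)+
    then show ?thesis using X(3)[of n] by linarith
  qed
  have exhaust: "\<exists>n. G \<subseteq> F n" if "finite G" "G \<subseteq> D" for G
    using that
  proof (induction G rule: finite_induct)
    case (insert V G)
    then obtain n where "G \<subseteq> F n" by auto
    moreover obtain m where "from_nat_into D m = V" using from_nat_into_surj[OF countable] insert by auto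
    then have "V \<in> F m" by (auto simp: F_def)
    ultimately show ?case using F_mono[of n "max m n"] F_mono[of m "max m n"] by (intro exI[of _ "max m n"]) auto
  qed simp
  define S where "S n x = (\<Sum>V\<in>F n. H V x)" for n x
  have S: "S n \<in> L2" for n unfolding S_def using F H by (intro L2_sum) auto
  have [measurable]: "S n \<in> borel_measurable lebesgue" for n using S by (rule L2_measurable)
  have S_diff: "(LINT x|lebesgue. (cmod (S n x - (\<Sum>V\<in>G. H V x)))\<^sup>2) \<le> K * (tot - sum s G)"
    if G: "G \<subseteq> F n" for G n
  proof -
    have fin: "finite G" using G F finite_subset by blast
    have "F n - G \<subseteq> D" using F(2)[of n] by blast
    moreover have "S n x - (\<Sum>V\<in>G. H V x) = (\<Sum>V\<in>F n - G. H V x)" for x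
      unfolding S_def using G F by (simp add: sum_diff)
    ultimately have "(LINT x|lebesgue. (cmod (S n x - (\<Sum>V\<in>G. H V x)))\<^sup>2) \<le> K * sum s (F n - G)"
      using bound[of "F n - G"] F(1)[of n] by (simp add: L2_norm_square)
    also have "\<dots> \<le> K * (tot - sum s G)"
      using le_tot[OF F] F G K by (intro mult_left_mono) (auto simp: sum_diff)
    finally show ?thesis .
  qed
  define u where "u n x = S (Suc n) x - S n x" for n x
  have u_int: "integrable lebesgue (\<lambda>x. (cmod (u n x))\<^sup>2)" for n
    unfolding u_def using S by (intro L2_integrable L2_diff)
  have [measurable]: "u n \<in> borel_measurable lebesgue" for n unfolding u_def by measurable
  have u_le: "(LINT x|lebesgue. (cmod (u n x))\<^sup>2) \<le> K * (1/4) ^ n" for n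
  proof -
    have "(LINT x|lebesgue. (cmod (u n x))\<^sup>2) \<le> K * (tot - sum s (F n))"
      using S_diff[OF F_mono[of n "Suc n"]] by (simp add: u_def S_def)
    also have "\<dots> \<le> K * (1/4) ^ n" using tail K by (intro mult_left_mono) auto
    finally show ?thesis .
  qed
  have "(\<integral>\<^sup>+x. (\<Sum>n. ennreal (2 ^ n * (cmod (u n x))\<^sup>2)) \<partial>lebesgue)
      = (\<Sum>n. \<integral>\<^sup>+x. ennreal (2 ^ n * (cmod (u n x))\<^sup>2) \<partial>lebesgue)"
    by (rule nn_integral_suminf) measurable
  also have "\<dots> = (\<Sum>n. ennreal (2 ^ n * (LINT x|lebesgue. (cmod (u n x))\<^sup>2)))"
    using u_int by (intro suminf_cong) (simp add: nn_integral_eq_integral)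
  also have "\<dots> \<le> (\<Sum>n. ennreal (K * (1/2) ^ n))"
  proof (intro suminf_le summableI ennreal_leI)
    fix n
    have "2 ^ n * (LINT x|lebesgue. (cmod (u n x))\<^sup>2) \<le> 2 ^ n * (K * (1/4) ^ n)"
      using u_le by (intro mult_left_mono) auto
    also have "\<dots> = K * (1/2) ^ n" by (simp add: power_divide field_simps flip: power_mult_distrib)
    finally show "2 ^ n * (LINT x|lebesgue. (cmod (u n x))\<^sup>2) \<le> K * (1/2) ^ n" .
  qed
  also have "\<dots> = ennreal (\<Sum>n. K * (1/2) ^ n)"
    using K by (intro suminf_ennreal2 summable_mult summable_geometric) auto
  also have "\<dots> < \<infinity>" by simp
  finally have "AE x in lebesgue. (\<Sum>n. ennreal (2 ^ n * (cmod (u n x))\<^sup>2)) \<noteq> \<infinity>"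
    by (intro nn_integral_PInf_AE) auto
  then have conv: "AE x in lebesgue. (\<lambda>n. S n x) \<longlonglongrightarrow> lim (\<lambda>n. S n x)"
  proof eventually_elim
    case (elim x)
    then have "summable (\<lambda>n. 2 ^ n * (cmod (u n x))\<^sup>2)"
      by (intro summable_suminf_not_top) auto
    moreover have "summable (\<lambda>n. (1/2::real) ^ n)" by (simp add: summable_geometric)
    ultimately have "summable (\<lambda>n. 2 ^ n * (cmod (u n x))\<^sup>2 + (1/2) ^ n)" by (rule summable_add)
    then have "summable (\<lambda>n. u n x)"
    proof (rule summable_comparison_test'[where N = 0])
      fix n
      \<comment> \<open>Arithmetic-geometric mean: a weighted square-summable sequence is summable.\<close>
      have "2 * cmod (u n x) * 1 \<le> 2 ^ n * (cmod (u n x))\<^sup>2 + (1/2) ^ n"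
      proof -
        have "0 \<le> (1/2) ^ n * (2 ^ n * cmod (u n x) - 1)\<^sup>2" by simp
        also have "\<dots> = 2 ^ n * (cmod (u n x))\<^sup>2 - 2 * cmod (u n x) + (1/2) ^ n"
          by (simp add: power2_eq_square field_simps power_divide)
        finally show ?thesis by simp
      qed
      moreover have "0 \<le> cmod (u n x)" by simp
      ultimately show "norm (u n x) \<le> 2 ^ n * (cmod (u n x))\<^sup>2 + (1/2) ^ n" by linarith
    qed
    moreover have "(\<Sum>k<n. u k x) = S n x - S 0 x" for n
      unfolding u_def by (rule sum_lessThan_telescope)
    ultimately have "(\<lambda>n. S n x - S 0 x) \<longlonglongrightarrow> suminf (\<lambda>n. u n x)"
      using summable_LIMSEQ[of "\<lambda>n. u n x"] by simp
    then have "(\<lambda>n. (S n x - S 0 x) + S 0 x) \<longlonglongrightarrow> suminf (\<lambda>n. u n x) + S 0 x"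
      by (intro tendsto_add tendsto_const)
    then have "convergent (\<lambda>n. S n x)" by (auto simp: convergent_def)
    then show ?case by (simp add: convergent_LIMSEQ_iff)
  qed
  define h where "h x = lim (\<lambda>n. S n x)" for x
  have [measurable]: "h \<in> borel_measurable lebesgue" unfolding h_def by measurable
  have near: "(\<lambda>x. h x - (\<Sum>V\<in>G. H V x)) \<in> L2 \<and>
      (L2_norm (\<lambda>x. h x - (\<Sum>V\<in>G. H V x)))\<^sup>2 \<le> K * (tot - sum s G)"
    if G: "finite G" "G \<subseteq> D" for G
  proof -
    define P where "P x = (\<Sum>V\<in>G. H V x)" for x
    have P: "P \<in> L2" unfolding P_def using H G by (intro L2_sum) auto
    note [measurable] = L2_measurable[OF P]
    obtain N where N: "G \<subseteq> F N" using exhaust[OF G] by blast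
    have K0: "0 \<le> K * (tot - sum s G)" using K le_tot[OF G] by simp
    have "(\<integral>\<^sup>+x. ennreal ((cmod (h x - P x))\<^sup>2) \<partial>lebesgue)
        = (\<integral>\<^sup>+x. liminf (\<lambda>n. ennreal ((cmod (S n x - P x))\<^sup>2)) \<partial>lebesgue)"
    proof (rule nn_integral_cong_AE)
      show "AE x in lebesgue. ennreal ((cmod (h x - P x))\<^sup>2) = liminf (\<lambda>n. ennreal ((cmod (S n x - P x))\<^sup>2))"
        using conv
      proof eventually_elim
        case (elim x)
        then have "(\<lambda>n. ennreal ((cmod (S n x - P x))\<^sup>2)) \<longlonglongrightarrow> ennreal ((cmod (h x - P x))\<^sup>2)"
          unfolding h_def by (intro tendsto_intros)
        then show ?case using lim_imp_Liminf[OF sequentially_bot] by metis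
      qed
    qed
    also have "\<dots> \<le> liminf (\<lambda>n. \<integral>\<^sup>+x. ennreal ((cmod (S n x - P x))\<^sup>2) \<partial>lebesgue)"
      by (rule nn_integral_liminf) measurable
    also have "\<dots> \<le> limsup (\<lambda>n. \<integral>\<^sup>+x. ennreal ((cmod (S n x - P x))\<^sup>2) \<partial>lebesgue)"
      by (rule Liminf_le_Limsup) simp
    also have "\<dots> \<le> ennreal (K * (tot - sum s G))"
    proof (rule Limsup_bounded)
      show "\<forall>\<^sub>F n in sequentially. (\<integral>\<^sup>+x. ennreal ((cmod (S n x - P x))\<^sup>2) \<partial>lebesgue) \<le> ennreal (K * (tot - sum s G))"
        unfolding eventually_sequentially
      proof (intro exI allI impI)
        fix n assume "N \<le> n"
        then have "G \<subseteq> F n" using N F_mono by blast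
        from S_diff[OF this]
        show "(\<integral>\<^sup>+x. ennreal ((cmod (S n x - P x))\<^sup>2) \<partial>lebesgue) \<le> ennreal (K * (tot - sum s G))"
          using L2_integrable[OF L2_diff[OF S P]] by (simp add: nn_integral_eq_integral ennreal_leI P_def)
      qed
    qed
    finally have nn: "(\<integral>\<^sup>+x. ennreal ((cmod (h x - P x))\<^sup>2) \<partial>lebesgue) \<le> ennreal (K * (tot - sum s G))" .
    have int: "integrable lebesgue (\<lambda>x. (cmod (h x - P x))\<^sup>2)"
      by (rule integrableI_bounded) (use nn in \<open>auto simp: less_top[symmetric] top_unique\<close>)
    then have "(\<lambda>x. h x - P x) \<in> L2" by (simp add: L2_def)
    moreover have "(L2_norm (\<lambda>x. h x - P x))\<^sup>2 \<le> K * (tot - sum s G)"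
      using nn int K0 by (simp add: L2_norm_square nn_integral_eq_integral)
    ultimately show ?thesis by (simp add: P_def)
  qed
  have h: "h \<in> L2" "(L2_norm h)\<^sup>2 \<le> K * tot" using near[of "{}"] by simp_all
  have "((\<lambda>V. pairing (H V) g) has_sum pairing h g) D" if g: "g \<in> L2" for g
  proof -
    have "((\<lambda>G. (\<Sum>V\<in>G. pairing (H V) g) - pairing h g) \<longlongrightarrow> 0) (finite_subsets_at_top D)"
    proof (rule Lim_null_comparison)
      show "\<forall>\<^sub>F G in finite_subsets_at_top D. norm ((\<Sum>V\<in>G. pairing (H V) g) - pairing h g)
          \<le> sqrt (K * (tot - sum s G)) * L2_norm g"
      proof (rule eventually_finite_subsets_at_top_weakI)
        fix G assume G: "finite G" "G \<subseteq> D"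
        have HG: "H V \<in> L2" if "V \<in> G" for V using H G that by blast
        have "pairing (\<lambda>x. h x - (\<Sum>V\<in>G. H V x)) g = pairing h g - (\<Sum>V\<in>G. pairing (H V) g)"
          using pairing_diff[OF h(1) L2_sum[of G H, OF HG] g] pairing_sum[of G H, OF HG g] by simp
        then have "norm ((\<Sum>V\<in>G. pairing (H V) g) - pairing h g) = cmod (pairing (\<lambda>x. h x - (\<Sum>V\<in>G. H V x)) g)"
          by (simp add: norm_minus_commute)
        also have "\<dots> \<le> L2_norm (\<lambda>x. h x - (\<Sum>V\<in>G. H V x)) * L2_norm g"
          using near[OF G] g by (intro pairing_le) auto
        also have "\<dots> \<le> sqrt (K * (tot - sum s G)) * L2_norm g"
          using near[OF G] L2_norm_nonneg by (intro mult_right_mono real_le_rsqrt) auto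
        finally show "norm ((\<Sum>V\<in>G. pairing (H V) g) - pairing h g)
          \<le> sqrt (K * (tot - sum s G)) * L2_norm g" .
      qed
      have "((\<lambda>G. sqrt (K * (tot - sum s G)) * L2_norm g) \<longlongrightarrow> sqrt (K * (tot - tot)) * L2_norm g) (finite_subsets_at_top D)"
        by (intro tendsto_intros lim)
      then show "((\<lambda>G. sqrt (K * (tot - sum s G)) * L2_norm g) \<longlongrightarrow> 0) (finite_subsets_at_top D)" by simp
    qed
    then show ?thesis unfolding has_sum_def by (rule LIM_zero_cancel)
  qed
  then show ?thesis using h by (auto simp: tot_def)
qed

lemma set_integrable_of_square:
  fixes u :: "real^'m \<Rightarrow> complex"
  assumes V: "V \<in> lmeasurable" and [measurable]: "u \<in> borel_measurable lebesgue"
    and sq: "set_integrable lebesgue V (\<lambda>x. (cmod (u x))\<^sup>2)"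
  shows "set_integrable lebesgue V u"
proof (rule set_integrable_bound)
  have [measurable]: "V \<in> sets lebesgue" using V by auto
  have "set_integrable lebesgue V (\<lambda>x. 1::real)"
    using V by (simp add: set_integrable_def lmeasurable_iff_integrable)
  then show "set_integrable lebesgue V (\<lambda>x. 1 + (cmod (u x))\<^sup>2)"
    using sq by (rule set_integral_add(1))
  show "set_borel_measurable lebesgue V u"
    unfolding set_borel_measurable_def by measurable
  have "cmod (u x) \<le> 1 + (cmod (u x))\<^sup>2" for x
  proof -
    have "0 \<le> 1 - 2 * cmod (u x) + (cmod (u x))\<^sup>2"
      using zero_le_power2[of "1 - cmod (u x)"] by (simp add: power2_diff)
    moreover have "0 \<le> cmod (u x)" by simp
    ultimately show ?thesis by linarith
  qed
  then show "AE x in lebesgue. x \<in> V \<longrightarrow> norm (u x) \<le> norm (1 + (cmod (u x))\<^sup>2)"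
    by (intro AE_I2) (simp add: abs_of_nonneg)
qed

lemma L2_set_integrable_square: "f \<in> L2 \<Longrightarrow> V \<in> sets lebesgue \<Longrightarrow> set_integrable lebesgue V (\<lambda>x. (cmod (f x))\<^sup>2)"
  using integrable_mult_indicator[OF _ L2_integrable, of V f] by (simp add: set_integrable_def)

lemma sum_mult_le_sqrt:
  fixes a b :: "'v \<Rightarrow> real"
  assumes "\<And>v. v \<in> S \<Longrightarrow> 0 \<le> a v" "\<And>v. v \<in> S \<Longrightarrow> 0 \<le> b v"
  shows "(\<Sum>v\<in>S. a v * b v) \<le> sqrt (\<Sum>v\<in>S. (a v)\<^sup>2) * sqrt (\<Sum>v\<in>S. (b v)\<^sup>2)"
proof -
  have "(\<Sum>v\<in>S. a v * b v) = (\<Sum>v\<in>S. \<bar>a v\<bar> * \<bar>b v\<bar>)"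
    using assms by (intro sum.cong) auto
  also have "\<dots> \<le> L2_set a S * L2_set b S" by (rule L2_set_mult_ineq)
  finally show ?thesis by (simp add: L2_set_def)
qed

section \<open>Sums over the cubes of a grid\<close>

sublocale dyadic \<subseteq> measured_tree D "children D" "measure lebesgue"
  by (rule measured_tree_grid)

context dyadic
begin

lemma jump_energy_nonneg: "0 \<le> jump_energy r V"
  unfolding jump_energy_def
  by (intro sum_nonneg mult_nonneg_nonneg) (simp_all)

text \<open>A local bound below every cube gives a global one: the cubes of a finite set have ancestors on
  a common level, and these ancestors are disjoint. A single common ancestor need not exist: in the
  standard grid no cube meets two of the half-open orthants.\<close>

lemma sum_le_by_descent:
  assumes f: "f \<in> L2" and K: "0 \<le> K" and t: "\<And>V. 0 \<le> t V"
    and local: "\<And>W n. W \<in> D \<Longrightarrow> descent_sum (children D) t n W \<le> K * (LINT x:W|lebesgue. (cmod (f x))\<^sup>2)"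
    and F: "finite F" "F \<subseteq> D"
  shows "sum t F \<le> K * (L2_norm f)\<^sup>2"
proof -
  have "\<exists>q. \<forall>V\<in>F. V \<in> grid_level D (q V)"
    using F(2) by (intro bchoice) (auto dest: in_level)
  then obtain q where q: "\<And>V. V \<in> F \<Longrightarrow> V \<in> grid_level D (q V)" by blast
  have "\<exists>p. \<forall>V\<in>F. p \<le> q V" using F(1) by (intro exI[of _ "Min (q ` F)"]) simp
  then obtain p where p: "\<And>V. V \<in> F \<Longrightarrow> p \<le> q V" by blast
  define m where "m V = nat (q V - p)" for V
  have "\<exists>N. \<forall>V\<in>F. m V < N" using F(1) finite_nat_set_iff_bounded[of "m ` F"] by simp
  then obtain N where N: "\<And>V. V \<in> F \<Longrightarrow> m V < N" by blast
  have "\<forall>V\<in>F. \<exists>W\<in>grid_level D p. V \<in> generation (children D) (m V) W"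
  proof
    fix V assume V: "V \<in> F"
    then have "V \<in> grid_level D (p + int (m V))" using q[OF V] p[OF V] by (simp add: m_def)
    then show "\<exists>W\<in>grid_level D p. V \<in> generation (children D) (m V) W" by (rule ancestor)
  qed
  then obtain top where top: "\<And>V. V \<in> F \<Longrightarrow> top V \<in> grid_level D p"
      "\<And>V. V \<in> F \<Longrightarrow> V \<in> generation (children D) (m V) (top V)"
    using bchoice[of F "\<lambda>V W. W \<in> grid_level D p \<and> V \<in> generation (children D) (m V) W"] by blast
  define Y where "Y W = {V \<in> F. top V = W}" for W
  have fY: "finite (Y W)" for W using F(1) by (simp add: Y_def)
  have topD: "W \<in> D" if "W \<in> top ` F" for W using that top(1) level_in by blast
  have meas: "W \<in> sets lebesgue" if "W \<in> top ` F" for W using lmeasurable[OF topD[OF that]] by auto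
  have "F = (\<Union>W\<in>top ` F. Y W)" by (auto simp: Y_def)
  then have "sum t F = sum t (\<Union>W\<in>top ` F. Y W)" by simp
  also have "\<dots> \<le> (\<Sum>W\<in>top ` F. sum t (Y W))"
    using F(1) fY t by (intro sum_UN_le) simp_all
  also have "\<dots> \<le> (\<Sum>W\<in>top ` F. K * (LINT x:W|lebesgue. (cmod (f x))\<^sup>2))"
  proof (rule sum_mono)
    fix W assume W: "W \<in> top ` F"
    have "Y W \<subseteq> (\<Union>k<N. generation (children D) k W)"
      using top(2) N by (auto simp: Y_def)
    then have "sum t (Y W) \<le> descent_sum (children D) t N W"
      using descent_sum_generations[OF topD[OF W], of t "Y W" N] fY t by blast
    also have "\<dots> \<le> K * (LINT x:W|lebesgue. (cmod (f x))\<^sup>2)" by (rule local[OF topD[OF W]])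
    finally show "sum t (Y W) \<le> K * (LINT x:W|lebesgue. (cmod (f x))\<^sup>2)" .
  qed
  also have "\<dots> = K * (LINT x:(\<Union>W\<in>top ` F. W)|lebesgue. (cmod (f x))\<^sup>2)"
  proof -
    have "disjoint_family_on (\<lambda>W. W) (top ` F)"
      using top(1) level_disjoint unfolding disjoint_family_on_def by blast
    then have "(LINT x:(\<Union>W\<in>top ` F. W)|lebesgue. (cmod (f x))\<^sup>2)
        = (\<Sum>W\<in>top ` F. LINT x:W|lebesgue. (cmod (f x))\<^sup>2)"
      using F(1) meas L2_set_integrable_square[OF f] by (intro set_integral_finite_Union) simp_all
    then show ?thesis by (simp add: sum_distrib_left)
  qed
  also have "\<dots> \<le> K * (LINT x|lebesgue. (cmod (f x))\<^sup>2)"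
  proof (rule mult_left_mono[OF _ K])
    have "(\<Union>W\<in>top ` F. W) \<in> sets lebesgue" using F(1) meas by (intro sets.finite_UN) auto
    then have "set_integrable lebesgue (\<Union>W\<in>top ` F. W) (\<lambda>x. (cmod (f x))\<^sup>2)"
      by (rule L2_set_integrable_square[OF f])
    then show "(LINT x:(\<Union>W\<in>top ` F. W)|lebesgue. (cmod (f x))\<^sup>2) \<le> (LINT x|lebesgue. (cmod (f x))\<^sup>2)"
      unfolding set_lebesgue_integral_def set_integrable_def
      by (intro integral_mono L2_integrable[OF f]) (auto simp: indicator_def)
  qed
  finally show ?thesis by (simp add: L2_norm_square)
qed

lemma E_op_eq:
  assumes V: "V \<in> grid_level D q" and x: "x \<in> V"
  shows "E_op D \<beta> q f x = weighted_mean \<beta> V f"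
proof -
  have "weighted_mean \<beta> W f * indicator W x = 0" if "W \<noteq> V" "W \<in> grid_level D q" for W
    using level_disjoint[OF that(2) V _ x] that by (auto simp: indicator_def)
  then have "E_op D \<beta> q f x = (\<Sum>\<^sub>\<infinity>W\<in>{V}. weighted_mean \<beta> W f * indicator W x)"
    unfolding E_op_def using V by (intro infsum_cong_neutral) auto
  then show ?thesis using x by simp
qed

lemma Delta_cube_eq:
  assumes V: "V \<in> D"
  shows "Delta_cube D \<beta> V f x
    = (\<Sum>W\<in>children D V. (weighted_mean \<beta> W f - weighted_mean \<beta> V f) * indicator W x)"
proof (cases "x \<in> V")
  case False
  then have "indicator W x = (0::complex)" if "W \<in> children D V" for W
    using children_subset[OF that] by (auto simp: indicator_def)
  then show ?thesis using False by (simp add: Delta_cube_def)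
next
  case True
  obtain q where q: "V \<in> grid_level D q" using in_level[OF V] by blast
  obtain W where W: "W \<in> children D V" "x \<in> W" using Union_children[OF V] True by blast
  then have Wq: "W \<in> grid_level D (q + 1)" using children_level[OF q] by simp
  have "(\<Sum>W\<in>children D V. (weighted_mean \<beta> W f - weighted_mean \<beta> V f) * indicator W x)
      = (\<Sum>W\<in>{W}. (weighted_mean \<beta> W f - weighted_mean \<beta> V f) * indicator W x)"
  proof (rule sum.mono_neutral_right)
    show "finite (children D V)" by (rule finite_children[OF V])
    show "\<forall>X\<in>children D V - {W}. (weighted_mean \<beta> X f - weighted_mean \<beta> V f) * indicator X x = 0"
    proof
      fix X assume X: "X \<in> children D V - {W}"
      then have "X \<in> grid_level D (q + 1)" using children_level[OF q] by simp
      then have "x \<notin> X" using level_disjoint[OF _ Wq _ W(2), of X] X by blast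
      then show "(weighted_mean \<beta> X f - weighted_mean \<beta> V f) * indicator X x = 0" by simp
    qed
  qed (use W in simp)
  then show ?thesis
    using True W(2) unfolding Delta_cube_def Delta_level_def the_level[OF q]
    by (simp add: E_op_eq[OF q True] E_op_eq[OF Wq W(2)])
qed

end

section \<open>Square functions adapted to a pseudo-accretive function\<close>

text \<open>The lower bound in \<open>accretive\<close> is not strict and \<open>B\<close> is only an almost everywhere bound, so the
  constant function 1 is covered with \<open>B = c = 1\<close>. That instance gives the unweighted estimates.\<close>

locale adapted = dyadic D for D :: "(real^'m) set set" +
  fixes \<beta> :: "real^'m \<Rightarrow> complex" and B c :: real
  assumes beta_measurable [measurable]: "\<beta> \<in> borel_measurable lebesgue"
    and beta_bounded: "AE x in lebesgue. cmod (\<beta> x) \<le> B"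
    and c_pos: "0 < c" and B_nonneg: "0 \<le> B"
    and accretive: "V \<in> cubes \<Longrightarrow> c * measure lebesgue V \<le> cmod (LINT x:V|lebesgue. \<beta> x)"
begin

lemma integral_beta_nonzero: "V \<in> D \<Longrightarrow> (LINT x:V|lebesgue. \<beta> x) \<noteq> 0"
  using accretive[OF in_cubes] mult_pos_pos[OF c_pos measure_pos] by fastforce

lemma set_integrable_mult_beta:
  assumes V: "V \<in> sets lebesgue" and [measurable]: "u \<in> borel_measurable lebesgue"
    and u: "set_integrable lebesgue V u"
  shows "set_integrable lebesgue V (\<lambda>x. u x * \<beta> x)"
proof (rule set_integrable_bound)
  note [measurable] = V
  show "set_integrable lebesgue V (\<lambda>x. complex_of_real B * u x)" using u by simp
  show "set_borel_measurable lebesgue V (\<lambda>x. u x * \<beta> x)"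
    unfolding set_borel_measurable_def by measurable
  show "AE x in lebesgue. x \<in> V \<longrightarrow> norm (u x * \<beta> x) \<le> norm (complex_of_real B * u x)"
    using beta_bounded
  proof eventually_elim
    case (elim x)
    then have "cmod (u x) * cmod (\<beta> x) \<le> cmod (u x) * B" by (intro mult_left_mono) auto
    then show ?case using B_nonneg by (simp add: norm_mult mult.commute)
  qed
qed

lemma set_integrable_beta: "V \<in> D \<Longrightarrow> set_integrable lebesgue V \<beta>"
proof -
  assume "V \<in> D"
  then have V: "V \<in> lmeasurable" by (rule lmeasurable)
  then have "set_integrable lebesgue V (\<lambda>x. 1::complex)"
    unfolding set_integrable_def lmeasurable_iff_integrable by (intro integrable_scaleR_left)
  then show ?thesis using set_integrable_mult_beta[of V "\<lambda>x. 1"] V by auto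
qed

lemma norm_integral_beta_le: "V \<in> D \<Longrightarrow> cmod (LINT x:V|lebesgue. \<beta> x) \<le> B * measure lebesgue V"
proof -
  assume "V \<in> D"
  then have V: "V \<in> lmeasurable" and i: "set_integrable lebesgue V \<beta>" by (auto intro: lmeasurable set_integrable_beta)
  have "cmod (LINT x:V|lebesgue. \<beta> x) \<le> (LINT x|lebesgue. norm (indicator V x *\<^sub>R \<beta> x))"
    unfolding set_lebesgue_integral_def by (rule integral_norm_bound)
  also have "\<dots> \<le> (LINT x|lebesgue. B * indicator V x)"
  proof (rule integral_mono_AE)
    show "integrable lebesgue (\<lambda>x. norm (indicator V x *\<^sub>R \<beta> x))" using i unfolding set_integrable_def by (rule integrable_norm)
    show "integrable lebesgue (\<lambda>x. B * indicat_real V x)" using V by (simp add: lmeasurable_iff_integrable)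
    show "AE x in lebesgue. norm (indicator V x *\<^sub>R \<beta> x) \<le> B * indicat_real V x"
      using beta_bounded by eventually_elim (auto simp: indicator_def)
  qed
  also have "\<dots> = B * measure lebesgue V" using V by (simp add: lmeasure_integral)
  finally show ?thesis .
qed

text \<open>Cauchy-Schwarz on \<open>V\<close>: this is the hypothesis on \<open>J\<close> and \<open>F\<close> in the estimates on trees, for
  \<open>J = \<integral> |u \<beta>|\<close> and \<open>F = B\<^sup>2 \<integral> |u|\<^sup>2\<close>.\<close>

lemma set_integral_square_beta:
  assumes V: "V \<in> D" and [measurable]: "u \<in> borel_measurable lebesgue"
    and sq: "set_integrable lebesgue V (\<lambda>x. (cmod (u x))\<^sup>2)"
  shows "(LINT x:V|lebesgue. cmod (u x * \<beta> x))\<^sup>2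
    \<le> B\<^sup>2 * (LINT x:V|lebesgue. (cmod (u x))\<^sup>2) * measure lebesgue V"
proof -
  have lV: "V \<in> lmeasurable" using V by (rule lmeasurable)
  then have [measurable]: "V \<in> sets lebesgue" by auto
  have iV: "integrable lebesgue (indicat_real V)" using lV by (simp add: lmeasurable_iff_integrable)
  define w where "w x = indicat_real V x * cmod (u x * \<beta> x)" for x
  have [measurable]: "w \<in> borel_measurable lebesgue" unfolding w_def by measurable
  have dom: "integrable lebesgue (\<lambda>x. B\<^sup>2 * (indicat_real V x * (cmod (u x))\<^sup>2))"
    using sq by (simp add: set_integrable_def)
  have le: "AE x in lebesgue. (w x)\<^sup>2 \<le> B\<^sup>2 * (indicat_real V x * (cmod (u x))\<^sup>2)"
    using beta_bounded
  proof eventually_elim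
    case (elim x)
    have "(cmod (\<beta> x))\<^sup>2 * (cmod (u x))\<^sup>2 \<le> B\<^sup>2 * (cmod (u x))\<^sup>2"
      using elim by (intro mult_right_mono power_mono) auto
    then show ?case by (cases "x \<in> V") (simp_all add: w_def norm_mult power_mult_distrib mult.commute)
  qed
  have w: "integrable lebesgue (\<lambda>x. (w x)\<^sup>2)"
    by (rule Bochner_Integration.integrable_bound[OF dom]) (measurable, use le in eventually_elim, simp)
  have ind: "(indicat_real V x)\<^sup>2 = indicat_real V x" for x by (simp add: indicator_def)
  have "(LINT x|lebesgue. w x * indicat_real V x)\<^sup>2
      \<le> (LINT x|lebesgue. (w x)\<^sup>2) * (LINT x|lebesgue. (indicat_real V x)\<^sup>2)"
  proof (rule integral_mult_square_le(2))
    show "integrable lebesgue (\<lambda>x. (indicat_real V x)\<^sup>2)" unfolding ind by (rule iV)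
  qed (use w in simp_all)
  also have "(LINT x|lebesgue. (indicat_real V x)\<^sup>2) = measure lebesgue V"
    unfolding ind using lV by (simp add: lmeasure_integral)
  also have "(LINT x|lebesgue. w x * indicat_real V x) = (LINT x:V|lebesgue. cmod (u x * \<beta> x))"
    unfolding set_lebesgue_integral_def by (rule Bochner_Integration.integral_cong) (auto simp: w_def indicator_def)
  also have "(LINT x|lebesgue. (w x)\<^sup>2) * measure lebesgue V
      \<le> (LINT x|lebesgue. B\<^sup>2 * (indicat_real V x * (cmod (u x))\<^sup>2)) * measure lebesgue V"
    using w dom le by (intro mult_right_mono integral_mono_AE) simp_all
  also have "(LINT x|lebesgue. B\<^sup>2 * (indicat_real V x * (cmod (u x))\<^sup>2))
      = B\<^sup>2 * (LINT x:V|lebesgue. (cmod (u x))\<^sup>2)"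
    by (simp add: set_lebesgue_integral_def)
  finally show ?thesis .
qed

text \<open>The second factor \<open>B\<^sup>2\<close> is the price of replacing \<open>\<integral> |u \<beta>|\<^sup>2\<close> by \<open>\<integral> |u|\<^sup>2\<close>.\<close>

definition K :: real where "K = (2 / c\<^sup>2 + 8 * B\<^sup>2 / c ^ 4) * B\<^sup>2"

lemma K_nonneg: "0 \<le> K"
  using c_pos by (simp add: K_def)

lemma square_function_local:
  assumes W: "W \<in> D" and u: "u \<in> borel_measurable lebesgue"
    and sq: "set_integrable lebesgue W (\<lambda>x. (cmod (u x))\<^sup>2)"
  shows "descent_sum (children D) (jump_energy (\<lambda>V. weighted_mean \<beta> V u)) n W
    \<le> K * (LINT x:W|lebesgue. (cmod (u x))\<^sup>2)"
proof -
  interpret T: measured_tree "{V \<in> D. V \<subseteq> W}" "children D" "measure lebesgue" by (rule measured_tree_below)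
  have sets: "V \<in> sets lebesgue" if "V \<in> D" for V using lmeasurable[OF that] by auto
  have sqV: "set_integrable lebesgue V (\<lambda>x. (cmod (u x))\<^sup>2)" if "V \<in> D" "V \<subseteq> W" for V
    using set_integrable_subset[OF sq sets[OF that(1)] that(2)] .
  have ub: "set_integrable lebesgue V (\<lambda>x. u x * \<beta> x)" if "V \<in> D" "V \<subseteq> W" for V
    using that by (intro set_integrable_mult_beta sets u set_integrable_of_square lmeasurable sqV)
  have "descent_sum (children D) (jump_energy (\<lambda>V. (LINT x:V|lebesgue. u x * \<beta> x) / (LINT x:V|lebesgue. \<beta> x))) n W
     \<le> (2 / c\<^sup>2 + 8 * B\<^sup>2 / c ^ 4) * (B\<^sup>2 * (LINT x:W|lebesgue. (cmod (u x))\<^sup>2))"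
  proof (rule T.adapted_square_function[where J = "\<lambda>V. LINT x:V|lebesgue. cmod (u x * \<beta> x)"])
    show "T.additive (\<lambda>V. LINT x:V|lebesgue. u x * \<beta> x)"
      using ub by (simp add: T.additive_def set_integral_children)
    show "T.additive (\<lambda>V. LINT x:V|lebesgue. \<beta> x)"
      using set_integrable_beta by (simp add: T.additive_def set_integral_children)
    show "T.additive (\<lambda>V. LINT x:V|lebesgue. cmod (u x * \<beta> x))"
      unfolding T.additive_def using ub[THEN set_integrable_norm] by (simp add: set_integral_children)
    show "T.additive (\<lambda>V. B\<^sup>2 * (LINT x:V|lebesgue. (cmod (u x))\<^sup>2))"
      using sqV by (simp add: T.additive_def set_integral_children flip: sum_distrib_left)
    show "W \<in> {V \<in> D. V \<subseteq> W}" using W by simp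
    fix V assume V: "V \<in> {V \<in> D. V \<subseteq> W}"
    show "cmod (LINT x:V|lebesgue. u x * \<beta> x) \<le> (LINT x:V|lebesgue. cmod (u x * \<beta> x))"
      using ub V by (intro set_integral_norm_bound) simp
    show "(LINT x:V|lebesgue. cmod (u x * \<beta> x))\<^sup>2
        \<le> B\<^sup>2 * (LINT x:V|lebesgue. (cmod (u x))\<^sup>2) * measure lebesgue V"
      using V u sqV by (intro set_integral_square_beta) simp_all
    show "cmod (LINT x:V|lebesgue. \<beta> x) \<le> B * measure lebesgue V"
      using V norm_integral_beta_le by simp
    show "c * measure lebesgue V \<le> cmod (LINT x:V|lebesgue. \<beta> x)"
      using V by (intro accretive in_cubes) simp
  qed (rule c_pos)
  then show ?thesis by (simp add: K_def weighted_mean_def)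
qed

lemma square_function:
  assumes g: "g \<in> L2" and F: "finite F" "F \<subseteq> D"
  shows "(\<Sum>V\<in>F. jump_energy (\<lambda>V. weighted_mean \<beta> V g) V) \<le> K * (L2_norm g)\<^sup>2"
proof (rule sum_le_by_descent[OF g K_nonneg _ _ F])
  show "descent_sum (children D) (jump_energy (\<lambda>V. weighted_mean \<beta> V g)) n W
      \<le> K * (LINT x:W|lebesgue. (cmod (g x))\<^sup>2)" if "W \<in> D" for W n
    using lmeasurable[OF that]
    by (intro square_function_local that L2_measurable g L2_set_integrable_square) auto
qed (rule jump_energy_nonneg)

lemma weighted_mean_minus_const:
  assumes V: "V \<in> D" and u: "u \<in> borel_measurable lebesgue" "set_integrable lebesgue V u"
  shows "weighted_mean \<beta> V (\<lambda>x. u x - k) = weighted_mean \<beta> V u - k"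
proof -
  have "set_integrable lebesgue V (\<lambda>x. u x * \<beta> x)"
    using lmeasurable[OF V] by (intro set_integrable_mult_beta u) auto
  moreover have "set_integrable lebesgue V (\<lambda>x. k * \<beta> x)"
    using set_integrable_beta[OF V] by simp
  ultimately have "(LINT x:V|lebesgue. (u x - k) * \<beta> x)
      = (LINT x:V|lebesgue. u x * \<beta> x) - k * (LINT x:V|lebesgue. \<beta> x)"
    by (simp add: left_diff_distrib set_integral_diff)
  then show ?thesis
    using integral_beta_nonzero[OF V] by (simp add: weighted_mean_def diff_divide_distrib)
qed

text \<open>Subtracting the constant \<open>mean W a\<close> changes no jump, and afterwards the square function estimate on
  \<open>W\<close> has the mean oscillation on its right-hand side.\<close>

lemma BMO_carleson:
  assumes a: "a \<in> BMO" and W: "W \<in> D"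
  shows "descent_sum (children D) (jump_energy (\<lambda>V. weighted_mean \<beta> V a)) n W
    \<le> K * (BMO_norm a)\<^sup>2 * measure lebesgue W"
proof -
  define u where "u x = a x - mean W a" for x
  have am: "a \<in> borel_measurable lebesgue" using a by (simp add: BMO_def)
  have ai: "set_integrable lebesgue V a" if "V \<in> D" for V
    using a in_cubes[OF that] by (simp add: BMO_def)
  have um: "u \<in> borel_measurable lebesgue" unfolding u_def using am by (intro borel_measurable_diff) auto
  have usq: "set_integrable lebesgue W (\<lambda>x. (cmod (u x))\<^sup>2)"
    using a in_cubes[OF W] by (simp add: BMO_def u_def)
  have wm: "weighted_mean \<beta> V u = weighted_mean \<beta> V a - mean W a" if "V \<in> D" for V
    unfolding u_def by (rule weighted_mean_minus_const[OF that am ai[OF that]])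
  have "descent_sum (children D) (jump_energy (\<lambda>V. weighted_mean \<beta> V a)) n W
      \<le> descent_sum (children D) (jump_energy (\<lambda>V. weighted_mean \<beta> V u)) n W"
  proof (rule descent_sum_mono[OF W])
    fix V assume "V \<in> D"
    then show "jump_energy (\<lambda>V. weighted_mean \<beta> V a) V \<le> jump_energy (\<lambda>V. weighted_mean \<beta> V u) V"
      unfolding jump_energy_def using wm ch_closed by (intro eq_refl sum.cong) auto
  qed
  also have "\<dots> \<le> K * (LINT x:W|lebesgue. (cmod (u x))\<^sup>2)"
    by (rule square_function_local[OF W um usq])
  also have "\<dots> \<le> K * ((BMO_norm a)\<^sup>2 * measure lebesgue W)"
  proof (rule mult_left_mono[OF _ K_nonneg])
    have I: "0 \<le> (LINT x:W|lebesgue. (cmod (u x))\<^sup>2)"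
      unfolding set_lebesgue_integral_def by (intro Bochner_Integration.integral_nonneg) simp
    have "mean_oscillation W a \<le> BMO_norm a"
      unfolding BMO_norm_def using a in_cubes[OF W] by (intro cSUP_upper) (auto simp: BMO_def)
    moreover have "0 \<le> mean_oscillation W a"
      using I by (simp add: mean_oscillation_def u_def)
    ultimately have "(mean_oscillation W a)\<^sup>2 \<le> (BMO_norm a)\<^sup>2" by (rule power_mono)
    moreover have "(mean_oscillation W a)\<^sup>2 = (LINT x:W|lebesgue. (cmod (u x))\<^sup>2) / measure lebesgue W"
      using I by (simp add: mean_oscillation_def u_def)
    ultimately show "(LINT x:W|lebesgue. (cmod (u x))\<^sup>2) \<le> (BMO_norm a)\<^sup>2 * measure lebesgue W"
      using measure_pos[OF W] by (simp add: pos_divide_le_eq)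
  qed
  finally show ?thesis by (simp add: mult.assoc)
qed

text \<open>Carleson embedding for the jump energies of \<open>a\<close>. The unweighted Cauchy-Schwarz inequality for \<open>f\<close>
  on a cube is the instance of \<open>set_integral_square_beta\<close> for the weight 1.\<close>

lemma paraproduct_coefficients:
  assumes a: "a \<in> BMO" and f: "f \<in> L2" and F: "finite F" "F \<subseteq> D"
  shows "(\<Sum>V\<in>F. jump_energy (\<lambda>V. weighted_mean \<beta> V a) V
      * ((LINT x:V|lebesgue. cmod (f x)) / measure lebesgue V)\<^sup>2)
    \<le> 4 * (K * (BMO_norm a)\<^sup>2) * (L2_norm f)\<^sup>2"
proof (rule sum_le_by_descent[OF f _ _ _ F])
  show "0 \<le> 4 * (K * (BMO_norm a)\<^sup>2)" using K_nonneg by simp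
  show "0 \<le> jump_energy (\<lambda>V. weighted_mean \<beta> V a) V
      * ((LINT x:V|lebesgue. cmod (f x)) / measure lebesgue V)\<^sup>2" for V
    by (intro mult_nonneg_nonneg jump_energy_nonneg zero_le_power2)
  fix W n assume W: "W \<in> D"
  have sets: "V \<in> sets lebesgue" if "V \<in> D" for V using lmeasurable[OF that] by auto
  have sq: "set_integrable lebesgue V (\<lambda>x. (cmod (f x))\<^sup>2)" if "V \<in> D" for V
    by (rule L2_set_integrable_square[OF f sets[OF that]])
  have fi: "set_integrable lebesgue V (\<lambda>x. cmod (f x))" if "V \<in> D" for V
    using that by (intro set_integrable_norm set_integrable_of_square lmeasurable L2_measurable f sq)
  show "descent_sum (children D) (\<lambda>V. jump_energy (\<lambda>V. weighted_mean \<beta> V a) V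
      * ((LINT x:V|lebesgue. cmod (f x)) / measure lebesgue V)\<^sup>2) n W
    \<le> 4 * (K * (BMO_norm a)\<^sup>2) * (LINT x:W|lebesgue. (cmod (f x))\<^sup>2)"
  proof (rule carleson_embedding)
    show "additive (\<lambda>V. LINT x:V|lebesgue. cmod (f x))"
      "additive (\<lambda>V. LINT x:V|lebesgue. (cmod (f x))\<^sup>2)"
      using fi sq by (simp_all add: additive_def set_integral_children)
    show "0 \<le> K * (BMO_norm a)\<^sup>2" using K_nonneg by simp
    fix V n assume V: "V \<in> D"
    show "descent_sum (children D) (jump_energy (\<lambda>V. weighted_mean \<beta> V a)) n V
        \<le> K * (BMO_norm a)\<^sup>2 * measure lebesgue V" by (rule BMO_carleson[OF a V])
    interpret one: adapted D "\<lambda>x. 1" 1 1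
    proof unfold_locales
      show "1 * measure lebesgue V \<le> cmod (LINT x:V|lebesgue. 1)" if "V \<in> cubes" for V :: "(real^'m) set"
      proof -
        have "V \<in> lmeasurable" using that measure_cube unfolding cubes_def by blast
        then have "(LINT x:V|lebesgue. (1::real)) = measure lebesgue V"
          by (simp add: set_lebesgue_integral_def lmeasure_integral)
        then have "(LINT x:V|lebesgue. complex_of_real 1) = complex_of_real (measure lebesgue V)"
          unfolding set_integral_complex_of_real by simp
        then show ?thesis by simp
      qed
    qed auto
    show "(LINT x:V|lebesgue. cmod (f x))\<^sup>2 \<le> (LINT x:V|lebesgue. (cmod (f x))\<^sup>2) * measure lebesgue V"
      using one.set_integral_square_beta[OF V L2_measurable[OF f] sq[OF V]] by simp
  qed (use W jump_energy_nonneg in auto)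
qed

lemma weighted_mean_le:
  assumes f: "f \<in> L2" and V: "V \<in> D"
  shows "cmod (weighted_mean \<beta> V f) \<le> B / c * ((LINT x:V|lebesgue. cmod (f x)) / measure lebesgue V)"
proof -
  have fi: "set_integrable lebesgue V f"
    using lmeasurable[OF V] by (intro set_integrable_of_square L2_measurable f L2_set_integrable_square) auto
  have fb: "set_integrable lebesgue V (\<lambda>x. f x * \<beta> x)"
    using lmeasurable[OF V] by (intro set_integrable_mult_beta L2_measurable f fi) auto
  have "cmod (LINT x:V|lebesgue. f x * \<beta> x) \<le> (LINT x:V|lebesgue. cmod (f x * \<beta> x))"
    by (rule set_integral_norm_bound[OF fb])
  also have "\<dots> \<le> (LINT x:V|lebesgue. B * cmod (f x))"
  proof (rule set_integral_mono_AE)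
    show "set_integrable lebesgue V (\<lambda>x. cmod (f x * \<beta> x))" using fb by (rule set_integrable_norm)
    show "set_integrable lebesgue V (\<lambda>x. B * cmod (f x))" using fi by (intro set_integrable_mult_right set_integrable_norm)
    show "AE x \<in> V in lebesgue. cmod (f x * \<beta> x) \<le> B * cmod (f x)"
      using beta_bounded by eventually_elim (simp add: norm_mult mult.commute mult_right_mono)
  qed
  finally have num: "cmod (LINT x:V|lebesgue. f x * \<beta> x) \<le> B * (LINT x:V|lebesgue. cmod (f x))" by simp
  have "cmod (weighted_mean \<beta> V f) = cmod (LINT x:V|lebesgue. f x * \<beta> x) / cmod (LINT x:V|lebesgue. \<beta> x)"
    by (simp add: weighted_mean_def norm_divide)
  also have "\<dots> \<le> (B * (LINT x:V|lebesgue. cmod (f x))) / (c * measure lebesgue V)"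
    using num accretive[OF in_cubes[OF V]] c_pos measure_pos[OF V] order_trans[OF norm_ge_zero num]
    by (intro frac_le) simp_all
  finally show ?thesis by simp
qed

lemma indicator_term_L2:
  assumes "W \<in> D"
  shows "(\<lambda>x. z * \<beta> x * indicator W x) \<in> L2"
proof (rule L2_dominated)
  have W: "W \<in> lmeasurable" using assms by (rule lmeasurable)
  then have [measurable]: "W \<in> sets lebesgue" by auto
  show "(\<lambda>x. z * \<beta> x * indicator W x) \<in> borel_measurable lebesgue" by measurable
  show "integrable lebesgue (\<lambda>x. (cmod z * B)\<^sup>2 * indicat_real W x)"
    using W by (simp add: lmeasurable_iff_integrable)
  show "AE x in lebesgue. (cmod (z * \<beta> x * indicator W x))\<^sup>2 \<le> (cmod z * B)\<^sup>2 * indicat_real W x"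
    using beta_bounded
  proof eventually_elim
    case (elim x)
    then have "cmod z * cmod (\<beta> x) \<le> cmod z * B" by (rule mult_left_mono) simp
    then have "(cmod z * cmod (\<beta> x))\<^sup>2 \<le> (cmod z * B)\<^sup>2" by (rule power_mono) simp
    then show ?case by (cases "x \<in> W") (simp_all add: norm_mult)
  qed
qed

lemma term_expand:
  assumes V: "V \<in> D"
  shows "(\<lambda>x. k * M_op \<beta> (Delta_cube D \<beta> V a) x)
    = (\<lambda>x. \<Sum>W\<in>children D V. (k * (weighted_mean \<beta> W a - weighted_mean \<beta> V a)) * \<beta> x * indicator W x)"
  unfolding M_op_def Delta_cube_eq[OF V] sum_distrib_left by (simp add: mult_ac)

lemma term_L2: "V \<in> D \<Longrightarrow> (\<lambda>x. k * M_op \<beta> (Delta_cube D \<beta> V a) x) \<in> L2"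
  unfolding term_expand by (intro L2_sum indicator_term_L2 children_in)

text \<open>The weighted difference \<open>\<beta> \<Delta>\<^sub>V a\<close> has integral zero (the fact \<open>zero\<close> below), so \<open>g\<close> may be replaced by
  its deviation from the weighted mean on \<open>V\<close>, and only the jumps \<open>e\<close> of \<open>g\<close> remain.\<close>

lemma pairing_term:
  assumes V: "V \<in> D" and a: "a \<in> BMO" and g: "g \<in> L2"
  shows "cmod (pairing (\<lambda>x. k * M_op \<beta> (Delta_cube D \<beta> V a) x) g)
    \<le> cmod k * B * (sqrt (jump_energy (\<lambda>V. weighted_mean \<beta> V a) V)
        * sqrt (jump_energy (\<lambda>V. weighted_mean \<beta> V g) V))"
proof -
  define \<Phi> where "\<Phi> W = (LINT x:W|lebesgue. \<beta> x)" for W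
  define d where "d W = weighted_mean \<beta> W a - weighted_mean \<beta> V a" for W
  define e where "e W = weighted_mean \<beta> W g - weighted_mean \<beta> V g" for W
  have chD: "W \<in> D" if "W \<in> children D V" for W using children_in[OF that] .
  have nz: "\<Phi> W \<noteq> 0" if "W \<in> D" for W unfolding \<Phi>_def by (rule integral_beta_nonzero[OF that])
  have a_int: "set_integrable lebesgue V (\<lambda>x. a x * \<beta> x)"
    using lmeasurable[OF V] a in_cubes[OF V] by (intro set_integrable_mult_beta) (auto simp: BMO_def)
  have zero: "(\<Sum>W\<in>children D V. d W * \<Phi> W) = 0"
  proof -
    have "(\<Sum>W\<in>children D V. d W * \<Phi> W)
        = (\<Sum>W\<in>children D V. LINT x:W|lebesgue. a x * \<beta> x) - weighted_mean \<beta> V a * (\<Sum>W\<in>children D V. \<Phi> W)"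
      unfolding d_def left_diff_distrib sum_subtractf sum_distrib_left
      using nz[OF chD] by (simp add: weighted_mean_def \<Phi>_def)
    also have "\<dots> = (LINT x:V|lebesgue. a x * \<beta> x) - weighted_mean \<beta> V a * \<Phi> V"
      using set_integral_children[OF V a_int] set_integral_children[OF V set_integrable_beta[OF V]]
      by (simp add: \<Phi>_def)
    also have "\<dots> = 0" using nz[OF V] by (simp add: weighted_mean_def \<Phi>_def)
    finally show ?thesis .
  qed
  have single: "pairing (\<lambda>x. z * \<beta> x * indicator W x) g = z * (weighted_mean \<beta> W g * \<Phi> W)"
    if "W \<in> D" for z W
  proof -
    have "pairing (\<lambda>x. z * \<beta> x * indicator W x) g = (LINT x|lebesgue. z * (indicat_real W x *\<^sub>R (g x * \<beta> x)))"
      unfolding pairing_def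
      by (rule Bochner_Integration.integral_cong) (auto simp: indicator_def)
    also have "\<dots> = z * (LINT x:W|lebesgue. g x * \<beta> x)"
      unfolding set_lebesgue_integral_def by (rule integral_mult_right_zero)
    finally show ?thesis using nz[OF that] by (simp add: weighted_mean_def \<Phi>_def)
  qed
  have "pairing (\<lambda>x. k * M_op \<beta> (Delta_cube D \<beta> V a) x) g
      = (\<Sum>W\<in>children D V. (k * d W) * (weighted_mean \<beta> W g * \<Phi> W))"
    unfolding term_expand[OF V] d_def
    by (subst pairing_sum[OF indicator_term_L2 g]) (simp_all add: chD single)
  also have "\<dots> = k * (\<Sum>W\<in>children D V. d W * e W * \<Phi> W) + k * weighted_mean \<beta> V g * (\<Sum>W\<in>children D V. d W * \<Phi> W)"
    unfolding sum_distrib_left sum.distrib[symmetric] by (simp add: e_def algebra_simps)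
  also have "\<dots> = k * (\<Sum>W\<in>children D V. d W * e W * \<Phi> W)" by (simp add: zero)
  finally have "cmod (pairing (\<lambda>x. k * M_op \<beta> (Delta_cube D \<beta> V a) x) g)
      = cmod k * cmod (\<Sum>W\<in>children D V. d W * e W * \<Phi> W)" by (simp add: norm_mult)
  also have "\<dots> \<le> cmod k * (\<Sum>W\<in>children D V. B * ((cmod (d W) * sqrt (measure lebesgue W)) * (cmod (e W) * sqrt (measure lebesgue W))))"
  proof (intro mult_left_mono norm_ge_zero order_trans[OF norm_sum] sum_mono)
    fix W assume "W \<in> children D V"
    then have "cmod (\<Phi> W) \<le> B * measure lebesgue W" unfolding \<Phi>_def by (intro norm_integral_beta_le chD)
    then have "cmod (d W) * cmod (e W) * cmod (\<Phi> W) \<le> cmod (d W) * cmod (e W) * (B * measure lebesgue W)"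
      by (intro mult_left_mono) simp_all
    also have "measure lebesgue W = sqrt (measure lebesgue W) * sqrt (measure lebesgue W)" by simp
    finally show "cmod (d W * e W * \<Phi> W) \<le> B * ((cmod (d W) * sqrt (measure lebesgue W)) * (cmod (e W) * sqrt (measure lebesgue W)))"
      by (simp add: norm_mult mult_ac)
  qed
  also have "\<dots> \<le> cmod k * (B * (sqrt (jump_energy (\<lambda>V. weighted_mean \<beta> V a) V)
        * sqrt (jump_energy (\<lambda>V. weighted_mean \<beta> V g) V)))"
  proof -
    have "(\<Sum>W\<in>children D V. (cmod (d W) * sqrt (measure lebesgue W)) * (cmod (e W) * sqrt (measure lebesgue W)))
       \<le> sqrt (\<Sum>W\<in>children D V. (cmod (d W) * sqrt (measure lebesgue W))\<^sup>2)
        * sqrt (\<Sum>W\<in>children D V. (cmod (e W) * sqrt (measure lebesgue W))\<^sup>2)"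
      by (rule sum_mult_le_sqrt) simp_all
    then show ?thesis unfolding sum_distrib_left[symmetric]
      using B_nonneg by (intro mult_left_mono) (simp_all add: jump_energy_def d_def e_def power_mult_distrib)
  qed
  finally show ?thesis by (simp add: mult.assoc)
qed

text \<open>The norm of a partial sum \<open>S\<close> is found by pairing it with its own conjugate \<open>g\<close>. The square
  function estimate for \<open>g\<close> then bounds \<open>\<parallel>S\<parallel>\<^sup>2\<close> by a multiple \<open>X\<close> of \<open>\<parallel>S\<parallel>\<close>, and \<open>\<parallel>S\<parallel>\<close> cancels.\<close>

lemma partial_sum_bound:
  assumes a: "a \<in> BMO" and F: "finite F" "F \<subseteq> D"
  shows "(L2_norm (\<lambda>x. \<Sum>V\<in>F. k V * M_op \<beta> (Delta_cube D \<beta> V a) x))\<^sup>2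
    \<le> B\<^sup>2 * K * (\<Sum>V\<in>F. (cmod (k V))\<^sup>2 * jump_energy (\<lambda>V. weighted_mean \<beta> V a) V)"
proof -
  define S where "S x = (\<Sum>V\<in>F. k V * M_op \<beta> (Delta_cube D \<beta> V a) x)" for x
  define g where "g x = cnj (S x)" for x
  define \<alpha> where "\<alpha> = jump_energy (\<lambda>V. weighted_mean \<beta> V a)"
  define \<gamma> where "\<gamma> = jump_energy (\<lambda>V. weighted_mean \<beta> V g)"
  have H: "(\<lambda>x. k V * M_op \<beta> (Delta_cube D \<beta> V a) x) \<in> L2" if "V \<in> F" for V
    using F that by (intro term_L2) auto
  have S: "S \<in> L2" unfolding S_def by (rule L2_sum[OF H])
  then have g: "g \<in> L2" unfolding g_def by (rule L2_cnj)
  have norm_g: "L2_norm g = L2_norm S" by (simp add: L2_norm_def g_def)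
  have nn: "0 \<le> \<alpha> V" "0 \<le> \<gamma> V" for V by (simp_all add: \<alpha>_def \<gamma>_def jump_energy_nonneg)
  define X where "X = B * (sqrt (\<Sum>V\<in>F. (cmod (k V))\<^sup>2 * \<alpha> V) * sqrt K)"
  have "complex_of_real ((L2_norm S)\<^sup>2) = (LINT x|lebesgue. complex_of_real ((cmod (S x))\<^sup>2))"
    by (simp only: L2_norm_square integral_complex_of_real)
  also have "\<dots> = pairing S g"
    unfolding pairing_def g_def by (simp only: complex_norm_square)
  also have "\<dots> = (\<Sum>V\<in>F. pairing (\<lambda>x. k V * M_op \<beta> (Delta_cube D \<beta> V a) x) g)"
    unfolding S_def by (rule pairing_sum[OF H g])
  finally have "(L2_norm S)\<^sup>2 = cmod (\<Sum>V\<in>F. pairing (\<lambda>x. k V * M_op \<beta> (Delta_cube D \<beta> V a) x) g)"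
    by (metis norm_of_real abs_of_nonneg zero_le_power2)
  also have "\<dots> \<le> (\<Sum>V\<in>F. cmod (k V) * B * (sqrt (\<alpha> V) * sqrt (\<gamma> V)))"
    unfolding \<alpha>_def \<gamma>_def using F a g by (intro order_trans[OF norm_sum] sum_mono pairing_term) auto
  also have "\<dots> = B * (\<Sum>V\<in>F. (cmod (k V) * sqrt (\<alpha> V)) * sqrt (\<gamma> V))"
    by (simp add: sum_distrib_left mult_ac)
  also have "\<dots> \<le> B * (sqrt (\<Sum>V\<in>F. (cmod (k V) * sqrt (\<alpha> V))\<^sup>2) * sqrt (\<Sum>V\<in>F. (sqrt (\<gamma> V))\<^sup>2))"
    using B_nonneg nn by (intro mult_left_mono sum_mult_le_sqrt) simp_all
  also have "\<dots> = B * (sqrt (\<Sum>V\<in>F. (cmod (k V))\<^sup>2 * \<alpha> V) * sqrt (\<Sum>V\<in>F. \<gamma> V))"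
    by (simp add: power_mult_distrib nn)
  also have "\<dots> \<le> B * (sqrt (\<Sum>V\<in>F. (cmod (k V))\<^sup>2 * \<alpha> V) * sqrt (K * (L2_norm S)\<^sup>2))"
    using square_function[OF g F] B_nonneg nn unfolding norm_g \<gamma>_def[symmetric]
    by (intro mult_left_mono real_sqrt_le_mono) (simp_all add: sum_nonneg)
  also have "\<dots> = X * L2_norm S"
    by (simp add: X_def real_sqrt_mult L2_norm_nonneg)
  finally have "L2_norm S * L2_norm S \<le> X * L2_norm S" by (simp add: power2_eq_square)
  moreover have X: "0 \<le> X" using B_nonneg K_nonneg nn by (simp add: X_def sum_nonneg)
  ultimately have "L2_norm S \<le> X"
    using L2_norm_nonneg[of S] by (cases "L2_norm S = 0") simp_all
  then have "(L2_norm S)\<^sup>2 \<le> X\<^sup>2" using L2_norm_nonneg by (rule power_mono)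
  also have "X\<^sup>2 = B\<^sup>2 * K * (\<Sum>V\<in>F. (cmod (k V))\<^sup>2 * \<alpha> V)"
    using K_nonneg nn by (simp add: X_def power_mult_distrib sum_nonneg)
  finally show ?thesis by (simp add: S_def[abs_def] \<alpha>_def)
qed

end

section \<open>Boundedness of the paraproduct\<close>

text \<open>The absolute value only makes the nonnegativity of the bound evident.\<close>

lemma adaptedI:
  assumes "dyadic_grid D" "\<beta> \<in> Linfty" "Linfty_norm \<beta> \<le> ereal B" "pseudo_accretive c \<beta>"
  shows "adapted D \<beta> \<bar>B\<bar> c"
proof
  show "dyadic_grid D" by fact
  show "\<beta> \<in> borel_measurable lebesgue" using assms(2) by (simp add: Linfty_def)
  have "AE x in lebesgue. ereal (cmod (\<beta> x)) \<le> Linfty_norm \<beta>"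
    unfolding Linfty_norm_def by (rule esssup_AE)
  then show "AE x in lebesgue. cmod (\<beta> x) \<le> \<bar>B\<bar>"
  proof eventually_elim
    case (elim x)
    then have "ereal (cmod (\<beta> x)) \<le> ereal B" using assms(3) by (rule order_trans)
    then show ?case by simp
  qed
  show "0 < c" using assms(4) by (simp add: pseudo_accretive_def)
  show "0 \<le> \<bar>B\<bar>" by simp
  fix V :: "(real^'a) set" assume V: "V \<in> cubes"
  then have "0 < measure lebesgue V" using measure_cube(2) unfolding cubes_def by blast
  then show "c * measure lebesgue V \<le> cmod (LINT x:V|lebesgue. \<beta> x)"
    using assms(4) V by (auto simp: pseudo_accretive_def field_simps dest!: bspec)
qed

text \<open>The squares \<open>s V\<close> of the coefficients, multiplied with the jump energies of \<open>a\<close>, dominate the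
  partial sums by \<open>partial_sum_bound\<close> and are summable by \<open>paraproduct_coefficients\<close>. The two
  square function constants combine to \<open>(2 B B' K / c')\<^sup>2\<close>.\<close>

lemma paraproduct_bounded:
  fixes \<beta> \<beta>' a :: "real^'m \<Rightarrow> complex"
  assumes "adapted D \<beta> B c" "adapted D \<beta>' B' c'" and a: "a \<in> BMO" and f: "f \<in> L2"
  shows "\<exists>h. is_paraproduct D \<beta>' \<beta> a f h \<and>
    L2_norm h \<le> 2 * B * B' / c' * ((2 / c\<^sup>2 + 8 * B\<^sup>2 / c ^ 4) * B\<^sup>2) * BMO_norm a * L2_norm f"
proof -
  interpret adapted D \<beta> B c by fact
  interpret p: adapted D \<beta>' B' c' by fact
  define \<alpha> where "\<alpha> = jump_energy (\<lambda>V. weighted_mean \<beta> V a)"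
  define s where "s V = (cmod (weighted_mean \<beta>' V f))\<^sup>2 * \<alpha> V" for V
  define R where "R = (B' / c')\<^sup>2 * (4 * (K * (BMO_norm a)\<^sup>2) * (L2_norm f)\<^sup>2)"
  have \<alpha>: "0 \<le> \<alpha> V" for V by (simp add: \<alpha>_def jump_energy_nonneg)
  then have s: "0 \<le> s V" for V by (simp add: s_def)
  have s_le: "sum s F \<le> R" if F: "finite F" "F \<subseteq> D" for F
  proof -
    have "sum s F \<le> (\<Sum>V\<in>F. (B' / c')\<^sup>2 * (\<alpha> V * ((LINT x:V|lebesgue. cmod (f x)) / measure lebesgue V)\<^sup>2))"
    proof (rule sum_mono)
      fix V assume "V \<in> F"
      then have "V \<in> D" using F by blast
      then have "(cmod (weighted_mean \<beta>' V f))\<^sup>2 \<le> (B' / c' * ((LINT x:V|lebesgue. cmod (f x)) / measure lebesgue V))\<^sup>2"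
        by (intro power_mono p.weighted_mean_le[OF f]) simp_all
      from mult_right_mono[OF this \<alpha>[of V]]
      show "s V \<le> (B' / c')\<^sup>2 * (\<alpha> V * ((LINT x:V|lebesgue. cmod (f x)) / measure lebesgue V)\<^sup>2)"
        unfolding s_def power_mult_distrib by (simp only: mult_ac)
    qed
    also have "\<dots> = (B' / c')\<^sup>2 * (\<Sum>V\<in>F. \<alpha> V * ((LINT x:V|lebesgue. cmod (f x)) / measure lebesgue V)\<^sup>2)"
      by (rule sum_distrib_left[symmetric])
    also have "\<dots> \<le> R"
      unfolding R_def \<alpha>_def by (intro mult_left_mono paraproduct_coefficients a f F) simp
    finally show ?thesis .
  qed
  have summable: "s summable_on D"
    using s s_le by (intro nonneg_bounded_partial_sums_imp_summable_on[where C = R]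
        eventually_finite_subsets_at_top_weakI) auto
  have inf: "infsum s D \<le> R"
    using summable s_le by (intro infsum_le_finite_sums) auto
  have "\<exists>h\<in>L2. (L2_norm h)\<^sup>2 \<le> (B\<^sup>2 * K) * infsum s D \<and>
      (\<forall>g\<in>L2. ((\<lambda>V. pairing (\<lambda>x. weighted_mean \<beta>' V f * M_op \<beta> (Delta_cube D \<beta> V a) x) g) has_sum pairing h g) D)"
  proof (rule L2_unconditional_series[OF countable_grid])
    show "(\<lambda>x. weighted_mean \<beta>' V f * M_op \<beta> (Delta_cube D \<beta> V a) x) \<in> L2" if "V \<in> D" for V
      by (rule term_L2[OF that])
    show "0 \<le> B\<^sup>2 * K" using K_nonneg by simp
    show "(L2_norm (\<lambda>x. \<Sum>V\<in>F. weighted_mean \<beta>' V f * M_op \<beta> (Delta_cube D \<beta> V a) x))\<^sup>2 \<le> B\<^sup>2 * K * sum s F"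
      if "finite F" "F \<subseteq> D" for F
      unfolding s_def \<alpha>_def by (rule partial_sum_bound[OF a that])
  qed (rule s summable)+
  then obtain h where h: "h \<in> L2" "(L2_norm h)\<^sup>2 \<le> (B\<^sup>2 * K) * infsum s D"
      "\<forall>g\<in>L2. ((\<lambda>V. pairing (\<lambda>x. weighted_mean \<beta>' V f * M_op \<beta> (Delta_cube D \<beta> V a) x) g) has_sum pairing h g) D"
    by blast
  have BMO0: "0 \<le> BMO_norm a"
  proof -
    have "cube 0 1 \<in> (cubes :: (real^'m) set set)" unfolding cubes_def using zero_less_one by blast
    then have "mean_oscillation (cube 0 1) a \<le> BMO_norm a"
      unfolding BMO_norm_def using a by (intro cSUP_upper) (auto simp: BMO_def)
    moreover have "0 \<le> mean_oscillation (cube 0 1) a"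
      by (simp add: mean_oscillation_def set_lebesgue_integral_def)
    ultimately show ?thesis by (rule order_trans[rotated])
  qed
  define C where "C = 2 * B * B' / c' * K * BMO_norm a * L2_norm f"
  have "(L2_norm h)\<^sup>2 \<le> (B\<^sup>2 * K) * R"
    using h(2) inf K_nonneg by (meson mult_left_mono mult_nonneg_nonneg order_trans zero_le_power2)
  also have "\<dots> = C\<^sup>2"
    by (simp add: R_def C_def power_mult_distrib power_divide) (simp add: power2_eq_square mult_ac)
  finally have "L2_norm h \<le> C"
  proof (rule power2_le_imp_le)
    show "0 \<le> C" unfolding C_def
      using B_nonneg p.B_nonneg p.c_pos K_nonneg BMO0 L2_norm_nonneg
      by (intro mult_nonneg_nonneg divide_nonneg_pos) simp_all
  qed
  then show ?thesis using h unfolding is_paraproduct_def C_def K_def by blast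
qed

theorem proposition3p2:
  shows
    "(\<forall>B B' c c' :: real. \<exists>C :: real.
        \<forall>(b2 :: real^'m \<Rightarrow> complex) b2' a D.
          b2 \<in> Linfty \<and> Linfty_norm b2 \<le> ereal B \<and> pseudo_accretive c b2 \<and>
          b2' \<in> Linfty \<and> Linfty_norm b2' \<le> ereal B' \<and> pseudo_accretive c' b2' \<and>
          a \<in> BMO \<and> dyadic_grid D \<longrightarrow>
          (\<forall>f\<in>L2. \<exists>h. is_paraproduct D b2' b2 a f h \<and>
             L2_norm h \<le> C * BMO_norm a * L2_norm f))
     \<and>
     (\<forall>B B' c c' :: real. \<exists>C :: real.
        \<forall>(b1 :: real^'n \<Rightarrow> complex) b1' a D.
          b1 \<in> Linfty \<and> Linfty_norm b1 \<le> ereal B \<and> pseudo_accretive c b1 \<and>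
          b1' \<in> Linfty \<and> Linfty_norm b1' \<le> ereal B' \<and> pseudo_accretive c' b1' \<and>
          a \<in> BMO \<and> dyadic_grid D \<longrightarrow>
          (\<forall>f\<in>L2. \<exists>h. is_paraproduct D b1' b1 a f h \<and>
             L2_norm h \<le> C * BMO_norm a * L2_norm f))"
  by (intro conjI allI; rule exI; intro allI impI ballI, elim conjE;
      rule paraproduct_bounded; (rule adaptedI)?; assumption)

end
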